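(* Let $K$ be a field with a valuation $v\colon K\to\mathbb{T}$ and let $V$ be a finite-dimensional $K$-vector space. Let $\mathcal{P}$ be the category whose objects are the finite presentations of $V$, i.e. pairs $(E,q)$ with $E$ a finite set and $q\colon K^{E}\twoheadrightarrow V$ a surjective $K$-linear map, and whose morphisms $(E_1,q_1)\to(E_2,q_2)$ are the maps of sets $\varphi\colon E_1\to E_2$ such that the induced linear map $\varphi_*\colon K^{E_1}\to K^{E_2}$, $x_e\mapsto x_{\varphi(e)}$, satisfies $q_2\circ\varphi_*=q_1$. Each such $\varphi$ induces a $\mathbb{T}$-linear map $\mathrm{trop}_{q_1}(V)\to\mathrm{trop}_{q_2}(V)$, $[x_e]\mapsto[x_{\varphi(e)}]$, so that $(E,q)\mapsto \mathrm{trop}_q(V)$ is a functor from $\mathcal{P}$ to $\mathbb{T}$-modules. Let $\widehat V=\bigoplus_{a\in V}K$ be the $K$-vector space with basis $\{x_a\mid a\in V\}$ indexed by the underlying set of $V$, and let $\pi\colon\widehat V\to V$ be the linear map with $\pi(x_a)=a$. Then the colimit, in $\mathbb{T}$-modules, of the tropicalizations of all finite presentations of $V$ is canonically isomorphic to the tropicalization of $\pi$: $$\operatorname*{colim}_{(E,q)\in\mathcal{P}}\ \mathrm{trop}_q(V)\ \xrightarrow{\ \cong\ }\ \mathrm{trop}_\pi(V),$$ where the isomorphism is induced by the compatible family of $\mathbb{T}$-linear maps $\mathrm{trop}_q(V)\to\mathrm{trop}_\pi(V)$, $[x_e]\mapsto[x_{q(x_e)}]$ for $e\in E$.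
   Context: The tropical semiring is $\mathbb{T}=\mathbb{R}\cup\{\infty\}$ with addition $a\oplus b=\min\{a,b\}$ (neutral element $\infty$) and multiplication $a\odot b=a+b$ (neutral element $0$; $a\odot\infty=\infty$). A $\mathbb{T}$-module is a commutative monoid with a compatible, bilinear, unital action of $\mathbb{T}$ in which $\infty$ acts as zero. A valuation on a field $K$ is a map $v\colon K\to\mathbb{T}$ with $v^{-1}(\infty)=\{0\}$, $v(ab)=v(a)+v(b)$ and $v(a+b)\ge\min\{v(a),v(b)\}$. For a (possibly infinite) set $S$, let $K^{(S)}=\bigoplus_{s\in S}K$ and $\mathbb{T}^{(S)}=\bigoplus_{s\in S}\mathbb{T}$ be the free modules with bases written $\{x_s\}_{s\in S}$ (elements are finitely supported; for $S$ finite these are $K^S$ and $\mathbb{T}^S$). For $f=\sum_s c_s x_s\in K^{(S)}$ put $\mathrm{trop}(f)=\bigoplus_s v(c_s)\odot x_s\in\mathbb{T}^{(S)}$, and for a linear subspace $L\subseteq K^{(S)}$ put $\mathrm{trop}(L)=\{\mathrm{trop}(f)\mid f\in L\}$. A congruence on a $\mathbb{T}$-module $M$ is an equivalence relation on $M$ that is compatible with addition and with scalar multiplication, so that the quotient is again a $\mathbb{T}$-module. For $g=\bigoplus_s g_s\odot x_s\in\mathbb{T}^{(S)}$ with support $\{s\mid g_s\ne\infty\}$, let $g_{\widehat t}=\bigoplus_{s\ne t}g_s\odot x_s$ be $g$ with its $t$-term deleted. The bend relations of $g$ are the relations $g\sim g_{\widehat t}$ for all $t$ in the support of $g$. For a subset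 $G\subseteq\mathbb{T}^{(S)}$, the bend congruence $\mathcal{B}(G)$ is the congruence of $\mathbb{T}$-modules on $\mathbb{T}^{(S)}$ generated by the bend relations of all $g\in G$. For a surjective linear map $q\colon K^{(S)}\twoheadrightarrow V$, the tropicalization of $V$ with respect to $q$ is the $\mathbb{T}$-module $\mathrm{trop}_q(V)=\mathbb{T}^{(S)}/\mathcal{B}\big(\mathrm{trop}(\ker q)\big)$. In particular $\mathrm{trop}_\pi(V)=\big(\bigoplus_{a\in V}\mathbb{T}\big)/\mathcal{B}\big(\mathrm{trop}(\ker\pi)\big)$. *)

theory Defs
  imports
    "HOL-Algebra.Module"
    "HOL-Library.FuncSet"
    "HOL-Library.Poly_Mapping"
    "HOL-Library.Infinite_Typeclass"
begin

section \<open>The tropical semiring\<close>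

text \<open>
  The type-class operations are the semiring operations: \<open>+\<close> is the minimum, \<open>*\<close> is the
  addition of real numbers, so that \<open>0\<close> is \<open>\<infinity>\<close> and \<open>1\<close> is the real number zero.
  The order is the usual one, with \<open>\<infinity>\<close> on top.
\<close>

datatype tropical = TReal real | TInf

instantiation tropical :: linorder
begin

fun less_eq_tropical :: "tropical \<Rightarrow> tropical \<Rightarrow> bool" where
  "less_eq_tropical x TInf \<longleftrightarrow> True"
| "less_eq_tropical TInf (TReal b) \<longleftrightarrow> False"
| "less_eq_tropical (TReal a) (TReal b) \<longleftrightarrow> a \<le> b"

definition less_tropical :: "tropical \<Rightarrow> tropical \<Rightarrow> bool" where
  "less_tropical x y \<longleftrightarrow> x \<le> y \<and> \<not> y \<le> x"

instance
proof
  fix x y z :: tropical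
  show "x < y \<longleftrightarrow> x \<le> y \<and> \<not> y \<le> x" by (rule less_tropical_def)
  show "x \<le> x" by (cases x) auto
  show "x \<le> y \<Longrightarrow> y \<le> z \<Longrightarrow> x \<le> z" by (cases x; cases y; cases z) auto
  show "x \<le> y \<Longrightarrow> y \<le> x \<Longrightarrow> x = y" by (cases x; cases y) auto
  show "x \<le> y \<or> y \<le> x" by (cases x; cases y) auto
qed

end

instantiation tropical :: comm_semiring_1
begin

definition zero_tropical :: tropical where "0 = TInf"

definition one_tropical :: tropical where "1 = TReal 0"

definition plus_tropical :: "tropical \<Rightarrow> tropical \<Rightarrow> tropical" where
  "plus_tropical x y = min x y"

fun times_tropical :: "tropical \<Rightarrow> tropical \<Rightarrow> tropical" where
  "times_tropical (TReal a) (TReal b) = TReal (a + b)"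
| "times_tropical TInf y = TInf"
| "times_tropical (TReal a) TInf = TInf"

instance
proof
  fix a b c :: tropical
  show "a + b + c = a + (b + c)" by (simp add: plus_tropical_def min.assoc)
  show "a + b = b + a" by (simp add: plus_tropical_def min.commute)
  show "0 + a = a" by (cases a) (auto simp: plus_tropical_def zero_tropical_def min_def)
  show "a * b * c = a * (b * c)" by (cases a; cases b; cases c) auto
  show "a * b = b * a" by (cases a; cases b) auto
  show "1 * a = a" by (cases a) (auto simp: one_tropical_def)
  show "(a + b) * c = a * c + b * c"
    by (cases a; cases b; cases c) (auto simp: plus_tropical_def min_def)
  show "0 * a = 0" by (simp add: zero_tropical_def)
  show "a * 0 = 0" by (cases a) (auto simp: zero_tropical_def)
  show "(0::tropical) \<noteq> 1" by (simp add: zero_tropical_def one_tropical_def)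
qed

end

definition valuation :: "('k::field \<Rightarrow> tropical) \<Rightarrow> bool" where
  "valuation v \<longleftrightarrow>
     (\<forall>a. v a = TInf \<longleftrightarrow> a = 0) \<and>
     (\<forall>a b. v (a * b) = v a * v b) \<and>
     (\<forall>a b. min (v a) (v b) \<le> v (a + b))"


section \<open>Modules over the tropical semiring\<close>

text \<open>
  The carrier records are those of \<^theory>\<open>HOL-Algebra.Module\<close>; as for modules over a ring,
  the fields \<open>mult\<close> and \<open>one\<close> play no role. The scalars are all elements of type
  \<^typ>\<open>tropical\<close>.
\<close>

locale tmodule = abelian_monoid M for M :: "(tropical, 'm) module" (structure) +
  assumes smult_closed: "x \<in> carrier M \<Longrightarrow> a \<odot> x \<in> carrier M"
    and smult_l_distr: "x \<in> carrier M \<Longrightarrow> (a + b) \<odot> x = a \<odot> x \<oplus> b \<odot> x"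
    and smult_r_distr: "x \<in> carrier M \<Longrightarrow> y \<in> carrier M \<Longrightarrow> a \<odot> (x \<oplus> y) = a \<odot> x \<oplus> a \<odot> y"
    and smult_assoc: "x \<in> carrier M \<Longrightarrow> (a * b) \<odot> x = a \<odot> (b \<odot> x)"
    and smult_one: "x \<in> carrier M \<Longrightarrow> 1 \<odot> x = x"
    and smult_l_zero: "x \<in> carrier M \<Longrightarrow> 0 \<odot> x = \<zero>"
    and smult_r_zero: "a \<odot> \<zero> = \<zero>"

definition tmod_hom :: "(tropical, 'm) module \<Rightarrow> (tropical, 'n) module \<Rightarrow> ('m \<Rightarrow> 'n) set" where
  "tmod_hom M N =
     {h \<in> carrier M \<rightarrow>\<^sub>E carrier N.
        (\<forall>x\<in>carrier M. \<forall>y\<in>carrier M. h (x \<oplus>\<^bsub>M\<^esub> y) = h x \<oplus>\<^bsub>N\<^esub> h y) \<and>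
        h \<zero>\<^bsub>M\<^esub> = \<zero>\<^bsub>N\<^esub> \<and>
        (\<forall>a. \<forall>x\<in>carrier M. h (a \<odot>\<^bsub>M\<^esub> x) = a \<odot>\<^bsub>N\<^esub> h x)}"

definition tmod_congruence :: "(tropical, 'm) module \<Rightarrow> ('m \<times> 'm) set \<Rightarrow> bool" where
  "tmod_congruence M r \<longleftrightarrow>
     equiv (carrier M) r \<and>
     (\<forall>(x, x')\<in>r. \<forall>(y, y')\<in>r. (x \<oplus>\<^bsub>M\<^esub> y, x' \<oplus>\<^bsub>M\<^esub> y') \<in> r) \<and>
     (\<forall>a. \<forall>(x, x')\<in>r. (a \<odot>\<^bsub>M\<^esub> x, a \<odot>\<^bsub>M\<^esub> x') \<in> r)"

definition tmod_congruence_gen ::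
    "(tropical, 'm) module \<Rightarrow> ('m \<times> 'm) set \<Rightarrow> ('m \<times> 'm) set" where
  "tmod_congruence_gen M R = \<Inter>{r. tmod_congruence M r \<and> R \<subseteq> r}"

definition tmod_quot ::
    "(tropical, 'm) module \<Rightarrow> ('m \<times> 'm) set \<Rightarrow> (tropical, 'm set) module" where
  "tmod_quot M r =
     \<lparr>carrier = carrier M // r,
      mult = undefined,
      one = undefined,
      zero = r `` {\<zero>\<^bsub>M\<^esub>},
      add = (\<lambda>X Y. \<Union>x\<in>X. \<Union>y\<in>Y. r `` {x \<oplus>\<^bsub>M\<^esub> y}),
      smult = (\<lambda>a X. \<Union>x\<in>X. r `` {a \<odot>\<^bsub>M\<^esub> x})\<rparr>"


section \<open>Free modules\<close>

text \<open>
  \<open>free_carrier S\<close> is the underlying set of the free module on \<open>S\<close>, over the field as well as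
  over the tropical semiring; the basis element \<open>x\<^sub>s\<close> is \<open>Poly_Mapping.single s 1\<close>.
  Over the tropical semiring \<^const>\<open>Poly_Mapping.keys\<close> collects the indices
  whose coefficient differs from \<open>\<infinity>\<close>.
\<close>

definition free_carrier :: "'s set \<Rightarrow> ('s \<Rightarrow>\<^sub>0 'c::zero) set" where
  "free_carrier S = {f. Poly_Mapping.keys f \<subseteq> S}"

definition scalar_mult :: "'c::mult_zero \<Rightarrow> ('s \<Rightarrow>\<^sub>0 'c) \<Rightarrow> ('s \<Rightarrow>\<^sub>0 'c)" where
  "scalar_mult c f = Poly_Mapping.map (\<lambda>b. c * b) f"

text \<open>The linear map \<open>x\<^sub>s \<mapsto> x\<^bsub>\<phi> s\<^esub>\<close>.\<close>

definition push :: "('s \<Rightarrow> 't) \<Rightarrow> ('s \<Rightarrow>\<^sub>0 'c::comm_monoid_add) \<Rightarrow> ('t \<Rightarrow>\<^sub>0 'c)" where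
  "push \<phi> f = (\<Sum>s\<in>Poly_Mapping.keys f. Poly_Mapping.single (\<phi> s) (Poly_Mapping.lookup f s))"

definition free_tmod :: "'s set \<Rightarrow> (tropical, 's \<Rightarrow>\<^sub>0 tropical) module" where
  "free_tmod S =
     \<lparr>carrier = free_carrier S, mult = undefined, one = undefined,
      zero = 0, add = (+), smult = scalar_mult\<rparr>"

definition free_linear_surj ::
    "('k::field \<Rightarrow> 'v::ab_group_add \<Rightarrow> 'v) \<Rightarrow> 's set \<Rightarrow> (('s \<Rightarrow>\<^sub>0 'k) \<Rightarrow> 'v) \<Rightarrow> bool" where
  "free_linear_surj scale S q \<longleftrightarrow>
     q \<in> extensional (free_carrier S) \<and>
     (\<forall>f\<in>free_carrier S. \<forall>g\<in>free_carrier S. q (f + g) = q f + q g) \<and>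
     (\<forall>c. \<forall>f\<in>free_carrier S. q (scalar_mult c f) = scale c (q f)) \<and>
     q ` free_carrier S = UNIV"


section \<open>Bend congruences and tropicalization\<close>

definition trop :: "('k::zero \<Rightarrow> tropical) \<Rightarrow> ('s \<Rightarrow>\<^sub>0 'k) \<Rightarrow> ('s \<Rightarrow>\<^sub>0 tropical)" where
  "trop v f = Poly_Mapping.map v f"

definition bend_relations :: "('s \<Rightarrow>\<^sub>0 tropical) set \<Rightarrow> (('s \<Rightarrow>\<^sub>0 tropical) \<times> ('s \<Rightarrow>\<^sub>0 tropical)) set"
  where "bend_relations G = {(g, Poly_Mapping.update t 0 g) | g t. g \<in> G \<and> t \<in> Poly_Mapping.keys g}"

definition bend_congruence ::
    "'s set \<Rightarrow> ('s \<Rightarrow>\<^sub>0 tropical) set \<Rightarrow> (('s \<Rightarrow>\<^sub>0 tropical) \<times> ('s \<Rightarrow>\<^sub>0 tropical)) set" where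
  "bend_congruence S G = tmod_congruence_gen (free_tmod S) (bend_relations G)"

definition ker_on :: "'s set \<Rightarrow> (('s \<Rightarrow>\<^sub>0 'k::zero) \<Rightarrow> 'v::zero) \<Rightarrow> ('s \<Rightarrow>\<^sub>0 'k) set" where
  "ker_on S q = {f \<in> free_carrier S. q f = 0}"

definition trop_congruence ::
    "('k::zero \<Rightarrow> tropical) \<Rightarrow> 's set \<Rightarrow> (('s \<Rightarrow>\<^sub>0 'k) \<Rightarrow> 'v::zero)
      \<Rightarrow> (('s \<Rightarrow>\<^sub>0 tropical) \<times> ('s \<Rightarrow>\<^sub>0 tropical)) set" where
  "trop_congruence v S q = bend_congruence S (trop v ` ker_on S q)"

definition tropicalization ::
    "('k::zero \<Rightarrow> tropical) \<Rightarrow> 's set \<Rightarrow> (('s \<Rightarrow>\<^sub>0 'k) \<Rightarrow> 'v::zero)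
      \<Rightarrow> (tropical, ('s \<Rightarrow>\<^sub>0 tropical) set) module" where
  "tropicalization v S q = tmod_quot (free_tmod S) (trop_congruence v S q)"

definition trop_generator ::
    "('k::zero \<Rightarrow> tropical) \<Rightarrow> 's set \<Rightarrow> (('s \<Rightarrow>\<^sub>0 'k) \<Rightarrow> 'v::zero) \<Rightarrow> 's
      \<Rightarrow> ('s \<Rightarrow>\<^sub>0 tropical) set" where
  "trop_generator v S q s = trop_congruence v S q `` {Poly_Mapping.single s 1}"

text \<open>The map of tropicalizations induced by a map \<open>\<phi>\<close> of the index sets.\<close>

definition trop_map ::
    "('k::zero \<Rightarrow> tropical) \<Rightarrow> 's set \<Rightarrow> (('s \<Rightarrow>\<^sub>0 'k) \<Rightarrow> 'v::zero)
      \<Rightarrow> 't set \<Rightarrow> (('t \<Rightarrow>\<^sub>0 'k) \<Rightarrow> 'v) \<Rightarrow> ('s \<Rightarrow> 't)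
      \<Rightarrow> ('s \<Rightarrow>\<^sub>0 tropical) set \<Rightarrow> ('t \<Rightarrow>\<^sub>0 tropical) set" where
  "trop_map v S q T p \<phi> =
     (\<lambda>X\<in>carrier (tropicalization v S q). \<Union>f\<in>X. trop_congruence v T p `` {push \<phi> f})"


section \<open>Categories, diagrams of tropical modules and their colimits\<close>

record ('o, 'a) category =
  Obj :: "'o set"
  Mor :: "'o \<Rightarrow> 'o \<Rightarrow> 'a set"
  Idn :: "'o \<Rightarrow> 'a"
  Cmp :: "'o \<Rightarrow> 'o \<Rightarrow> 'o \<Rightarrow> 'a \<Rightarrow> 'a \<Rightarrow> 'a"

text \<open>\<open>Cmp C X Y Z g f\<close> is the composite of \<open>f : X \<rightarrow> Y\<close> followed by \<open>g : Y \<rightarrow> Z\<close>.\<close>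

definition is_category :: "('o, 'a) category \<Rightarrow> bool" where
  "is_category C \<longleftrightarrow>
     (\<forall>X\<in>Obj C. Idn C X \<in> Mor C X X) \<and>
     (\<forall>X\<in>Obj C. \<forall>Y\<in>Obj C. \<forall>Z\<in>Obj C. \<forall>f\<in>Mor C X Y. \<forall>g\<in>Mor C Y Z.
        Cmp C X Y Z g f \<in> Mor C X Z) \<and>
     (\<forall>X\<in>Obj C. \<forall>Y\<in>Obj C. \<forall>f\<in>Mor C X Y.
        Cmp C X X Y f (Idn C X) = f \<and> Cmp C X Y Y (Idn C Y) f = f) \<and>
     (\<forall>W\<in>Obj C. \<forall>X\<in>Obj C. \<forall>Y\<in>Obj C. \<forall>Z\<in>Obj C.
        \<forall>f\<in>Mor C W X. \<forall>g\<in>Mor C X Y. \<forall>h\<in>Mor C Y Z.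
          Cmp C W Y Z h (Cmp C W X Y g f) = Cmp C W X Z (Cmp C X Y Z h g) f)"

definition tmod_functor ::
    "('o, 'a) category \<Rightarrow> ('o \<Rightarrow> (tropical, 'm) module) \<Rightarrow> ('o \<Rightarrow> 'o \<Rightarrow> 'a \<Rightarrow> 'm \<Rightarrow> 'm) \<Rightarrow> bool" where
  "tmod_functor C F A \<longleftrightarrow>
     (\<forall>X\<in>Obj C. tmodule (F X)) \<and>
     (\<forall>X\<in>Obj C. \<forall>Y\<in>Obj C. \<forall>f\<in>Mor C X Y. A X Y f \<in> tmod_hom (F X) (F Y)) \<and>
     (\<forall>X\<in>Obj C. A X X (Idn C X) = (\<lambda>x\<in>carrier (F X). x)) \<and>
     (\<forall>X\<in>Obj C. \<forall>Y\<in>Obj C. \<forall>Z\<in>Obj C. \<forall>f\<in>Mor C X Y. \<forall>g\<in>Mor C Y Z.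
        A X Z (Cmp C X Y Z g f) = compose (carrier (F X)) (A Y Z g) (A X Y f))"

definition tmod_cocone ::
    "('o, 'a) category \<Rightarrow> ('o \<Rightarrow> (tropical, 'm) module) \<Rightarrow> ('o \<Rightarrow> 'o \<Rightarrow> 'a \<Rightarrow> 'm \<Rightarrow> 'm)
      \<Rightarrow> (tropical, 'n) module \<Rightarrow> ('o \<Rightarrow> 'm \<Rightarrow> 'n) \<Rightarrow> bool" where
  "tmod_cocone C F A N \<kappa> \<longleftrightarrow>
     tmodule N \<and>
     (\<forall>X\<in>Obj C. \<kappa> X \<in> tmod_hom (F X) N) \<and>
     (\<forall>X\<in>Obj C. \<forall>Y\<in>Obj C. \<forall>f\<in>Mor C X Y. compose (carrier (F X)) (\<kappa> Y) (A X Y f) = \<kappa> X)"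

text \<open>
  The universal property of a colimit cocone, tested against all modules with elements of a
  type \<open>'n\<close>. A formula cannot quantify over types, so \<open>'n\<close> is passed as a parameter;
  a theorem in which it is a type variable asserts the universal property in full.
\<close>

definition tmod_colimit ::
    "'n itself \<Rightarrow> ('o, 'a) category \<Rightarrow> ('o \<Rightarrow> (tropical, 'm) module)
      \<Rightarrow> ('o \<Rightarrow> 'o \<Rightarrow> 'a \<Rightarrow> 'm \<Rightarrow> 'm) \<Rightarrow> (tropical, 'l) module \<Rightarrow> ('o \<Rightarrow> 'm \<Rightarrow> 'l) \<Rightarrow> bool" where
  "tmod_colimit _ C F A L \<iota> \<longleftrightarrow>
     tmod_cocone C F A L \<iota> \<and>
     (\<forall>(N :: (tropical, 'n) module) \<kappa>. tmod_cocone C F A N \<kappa> \<longrightarrow>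
        (\<exists>!h. h \<in> tmod_hom L N \<and> (\<forall>X\<in>Obj C. compose (carrier (F X)) h (\<iota> X) = \<kappa> X)))"


section \<open>The category of finite presentations\<close>

text \<open>
  The finite index sets are the finite subsets of a fixed type. When that type is infinite,
  this is, up to equivalence, the category of all finite presentations.
\<close>

definition finite_presentations ::
    "('k::field \<Rightarrow> 'v::ab_group_add \<Rightarrow> 'v)
      \<Rightarrow> ('e set \<times> (('e \<Rightarrow>\<^sub>0 'k) \<Rightarrow> 'v), 'e \<Rightarrow> 'e) category" where
  "finite_presentations scale =
     \<lparr>Obj = {(E, q). finite E \<and> free_linear_surj scale E q},
      Mor = (\<lambda>(E\<^sub>1, q\<^sub>1) (E\<^sub>2, q\<^sub>2).
        {\<phi> \<in> E\<^sub>1 \<rightarrow>\<^sub>E E\<^sub>2. \<forall>f\<in>free_carrier E\<^sub>1. q\<^sub>2 (push \<phi> f) = q\<^sub>1 f}),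
      Idn = (\<lambda>(E, q). \<lambda>e\<in>E. e),
      Cmp = (\<lambda>(E\<^sub>1, q\<^sub>1) _ _ \<psi> \<phi>. compose E\<^sub>1 \<psi> \<phi>)\<rparr>"

definition trop_obj ::
    "('k::field \<Rightarrow> tropical) \<Rightarrow> 'e set \<times> (('e \<Rightarrow>\<^sub>0 'k) \<Rightarrow> 'v::ab_group_add)
      \<Rightarrow> (tropical, ('e \<Rightarrow>\<^sub>0 tropical) set) module" where
  "trop_obj v = (\<lambda>(E, q). tropicalization v E q)"

definition trop_mor ::
    "('k::field \<Rightarrow> tropical) \<Rightarrow> 'e set \<times> (('e \<Rightarrow>\<^sub>0 'k) \<Rightarrow> 'v::ab_group_add)
      \<Rightarrow> 'e set \<times> (('e \<Rightarrow>\<^sub>0 'k) \<Rightarrow> 'v) \<Rightarrow> ('e \<Rightarrow> 'e)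
      \<Rightarrow> ('e \<Rightarrow>\<^sub>0 tropical) set \<Rightarrow> ('e \<Rightarrow>\<^sub>0 tropical) set" where
  "trop_mor v = (\<lambda>(E\<^sub>1, q\<^sub>1) (E\<^sub>2, q\<^sub>2) \<phi>. trop_map v E\<^sub>1 q\<^sub>1 E\<^sub>2 q\<^sub>2 \<phi>)"

definition trop_cocone ::
    "('k::field \<Rightarrow> tropical) \<Rightarrow> (('v \<Rightarrow>\<^sub>0 'k) \<Rightarrow> 'v)
      \<Rightarrow> 'e set \<times> (('e \<Rightarrow>\<^sub>0 'k) \<Rightarrow> 'v::ab_group_add)
      \<Rightarrow> ('e \<Rightarrow>\<^sub>0 tropical) set \<Rightarrow> ('v \<Rightarrow>\<^sub>0 tropical) set" where
  "trop_cocone v \<pi> =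
     (\<lambda>(E, q). trop_map v E q UNIV \<pi> (\<lambda>e. q (Poly_Mapping.single e 1)))"

end

theory Submission
  imports Defs
begin

section \<open>Congruences and quotients of tropical modules\<close>

text \<open>A vector of the free module on V has finite support, so it lives on a finite subset A of
  V, which may be enlarged to contain \<open>Basis\<close>. Such an A, with x_a sent to a, is itself
  a finite presentation, and a finite presentation (E, q) maps to it by e -> q(x_e) as soon as A
  contains all q(x_e). These presentations map to each other along inclusions and form a directed
  family. Each vector of the free module on V, and each vector of the kernel of \<pi>, occurs at
  some A; this is why the tropicalization of \<pi> is the colimit.

  The main difficulty is functoriality. Coefficients are added along the fibres of a map \<phi> of
  index sets, so cancellation may keep \<open>trop v\<close> from commuting with
  \<open>push \<phi>\<close>, and the image of a bend relation need not be a bend relation.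
  \<open>push_bend\<close> shows that it still lies in the bend congruence of the target, and
  \<open>push_trop_congruence\<close> extends this to the whole congruence.

  For the universal property (\<open>tmod_cocone_factorization\<close>), a cocone assigns at each A
  a value to every vector supported in A. Compatibility with inclusions glues these values to a
  linear map on the free module on V. It respects the bend relations, because each of them can be
  checked at a single A, and so descends to the quotient by \<open>tmod_quot_lift\<close>. It is
  unique because every class comes from some A.\<close>

lemma tmodule_tmod_closed:
  assumes "tmodule M"
  shows "\<zero>\<^bsub>M\<^esub> \<in> carrier M"
    and "x \<in> carrier M \<Longrightarrow> y \<in> carrier M \<Longrightarrow> x \<oplus>\<^bsub>M\<^esub> y \<in> carrier M"
    and "x \<in> carrier M \<Longrightarrow> a \<odot>\<^bsub>M\<^esub> x \<in> carrier M"
proof -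
  interpret tmodule M by fact
  show "\<zero>\<^bsub>M\<^esub> \<in> carrier M" by simp
  show "x \<in> carrier M \<Longrightarrow> y \<in> carrier M \<Longrightarrow> x \<oplus>\<^bsub>M\<^esub> y \<in> carrier M" by simp
  show "x \<in> carrier M \<Longrightarrow> a \<odot>\<^bsub>M\<^esub> x \<in> carrier M" by (rule smult_closed)
qed

section \<open>Homomorphisms and generated congruences\<close>

lemma tmod_homI:
  assumes "h \<in> extensional (carrier M)"
    and "\<And>x. x \<in> carrier M \<Longrightarrow> h x \<in> carrier N"
    and "\<And>x y. x \<in> carrier M \<Longrightarrow> y \<in> carrier M \<Longrightarrow> h (x \<oplus>\<^bsub>M\<^esub> y) = h x \<oplus>\<^bsub>N\<^esub> h y"
    and "h \<zero>\<^bsub>M\<^esub> = \<zero>\<^bsub>N\<^esub>"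
    and "\<And>a x. x \<in> carrier M \<Longrightarrow> h (a \<odot>\<^bsub>M\<^esub> x) = a \<odot>\<^bsub>N\<^esub> h x"
  shows "h \<in> tmod_hom M N"
  using assms by (auto simp: tmod_hom_def PiE_def)

lemma tmod_homD:
  assumes "h \<in> tmod_hom M N"
  shows "h \<in> extensional (carrier M)"
    and "x \<in> carrier M \<Longrightarrow> h x \<in> carrier N"
    and "x \<in> carrier M \<Longrightarrow> y \<in> carrier M \<Longrightarrow> h (x \<oplus>\<^bsub>M\<^esub> y) = h x \<oplus>\<^bsub>N\<^esub> h y"
    and "h \<zero>\<^bsub>M\<^esub> = \<zero>\<^bsub>N\<^esub>"
    and "x \<in> carrier M \<Longrightarrow> h (a \<odot>\<^bsub>M\<^esub> x) = a \<odot>\<^bsub>N\<^esub> h x"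
  using assms by (auto simp: tmod_hom_def PiE_def)

lemma tmod_congruenceD:
  assumes "tmod_congruence M r"
  shows "equiv (carrier M) r"
    and "(x, x') \<in> r \<Longrightarrow> (y, y') \<in> r \<Longrightarrow> (x \<oplus>\<^bsub>M\<^esub> y, x' \<oplus>\<^bsub>M\<^esub> y') \<in> r"
    and "(x, x') \<in> r \<Longrightarrow> (a \<odot>\<^bsub>M\<^esub> x, a \<odot>\<^bsub>M\<^esub> x') \<in> r"
  using assms unfolding tmod_congruence_def by blast+

text \<open>An intersection of congruences is a congruence. The assumption on \<open>R\<close> makes
  the total relation a member of the family, which keeps the intersection inside
  \<open>carrier M \<times> carrier M\<close>.\<close>

lemma tmod_congruence_gen_congruence:
  assumes M: "tmodule M" and R: "R \<subseteq> carrier M \<times> carrier M"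
  shows "tmod_congruence M (tmod_congruence_gen M R)"
proof -
  note cl = tmodule_tmod_closed[OF M]
  let ?C = "{r. tmod_congruence M r \<and> R \<subseteq> r}"
  have total: "carrier M \<times> carrier M \<in> ?C"
    using R cl by (auto simp: tmod_congruence_def equiv_def refl_on_def sym_def trans_def)
  have "equiv (carrier M) (\<Inter> ?C)"
  proof (rule equivI)
    show "\<Inter> ?C \<subseteq> carrier M \<times> carrier M" using total by blast
    show "refl_on (carrier M) (\<Inter> ?C)"
      by (auto simp: refl_on_def tmod_congruence_def equiv_def)
    show "sym (\<Inter> ?C)"
      by (rule symI) (auto simp: tmod_congruence_def equiv_def dest: symD)
    show "trans (\<Inter> ?C)"
    proof (rule transI, rule InterI)
      fix x y z r assume "(x, y) \<in> \<Inter> ?C" "(y, z) \<in> \<Inter> ?C" and r: "r \<in> ?C"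
      then have "(x, y) \<in> r" "(y, z) \<in> r" by blast+
      moreover have "trans r" using r by (auto simp: tmod_congruence_def equiv_def)
      ultimately show "(x, z) \<in> r" by (blast dest: transD)
    qed
  qed
  then show ?thesis
    unfolding tmod_congruence_gen_def tmod_congruence_def[of M "\<Inter> ?C"]
    by (auto dest: tmod_congruenceD(2,3))
qed

lemma tmod_congruence_gen_superset: "R \<subseteq> tmod_congruence_gen M R"
  by (auto simp: tmod_congruence_gen_def)

lemma tmod_congruence_gen_least:
  "tmod_congruence M r \<Longrightarrow> R \<subseteq> r \<Longrightarrow> tmod_congruence_gen M R \<subseteq> r"
  by (auto simp: tmod_congruence_gen_def)

lemma tmod_congruence_Id_on:
  assumes "tmodule M"
  shows "tmod_congruence M (Id_on (carrier M))"
  using tmodule_tmod_closed[OF assms]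
  by (auto simp: tmod_congruence_def equiv_def refl_on_def sym_def trans_def)

text \<open>Serves to show that a map respects a generated congruence: once the pullback is known to
  be a congruence, only the generators have to be checked. The congruence \<open>s\<close> will be a
  bend congruence in one use and equality on the carrier in the other.\<close>

lemma tmod_congruence_pullback:
  assumes M: "tmodule M" and s: "tmod_congruence N s"
    and closed: "\<And>x. x \<in> carrier M \<Longrightarrow> h x \<in> carrier N"
    and add: "\<And>x y. x \<in> carrier M \<Longrightarrow> y \<in> carrier M \<Longrightarrow> h (x \<oplus>\<^bsub>M\<^esub> y) = h x \<oplus>\<^bsub>N\<^esub> h y"
    and smult: "\<And>a x. x \<in> carrier M \<Longrightarrow> h (a \<odot>\<^bsub>M\<^esub> x) = a \<odot>\<^bsub>N\<^esub> h x"
  shows "tmod_congruence M {(x, y) \<in> carrier M \<times> carrier M. (h x, h y) \<in> s}"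
proof -
  note cl = tmodule_tmod_closed[OF M]
  note s' = tmod_congruenceD[OF s]
  have "equiv (carrier M) {(x, y) \<in> carrier M \<times> carrier M. (h x, h y) \<in> s}"
    using s'(1) closed unfolding equiv_def refl_on_def sym_def trans_def by blast
  then show ?thesis
    unfolding tmod_congruence_def
    using cl s'(2,3) by (auto simp: add smult)
qed

section \<open>Quotient modules and maps out of them\<close>

lemma tmod_quot_class:
  assumes M: "tmodule M" and r: "tmod_congruence M r"
  shows "x \<in> carrier M \<Longrightarrow> y \<in> carrier M \<Longrightarrow>
      r `` {x} \<oplus>\<^bsub>tmod_quot M r\<^esub> r `` {y} = r `` {x \<oplus>\<^bsub>M\<^esub> y}"
    and "x \<in> carrier M \<Longrightarrow> a \<odot>\<^bsub>tmod_quot M r\<^esub> r `` {x} = r `` {a \<odot>\<^bsub>M\<^esub> x}"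
proof -
  note cl = tmodule_tmod_closed[OF M]
  note r' = tmod_congruenceD[OF r]
  show "r `` {x} \<oplus>\<^bsub>tmod_quot M r\<^esub> r `` {y} = r `` {x \<oplus>\<^bsub>M\<^esub> y}"
    if "x \<in> carrier M" "y \<in> carrier M"
  proof -
    have "r `` {x' \<oplus>\<^bsub>M\<^esub> y'} = r `` {x \<oplus>\<^bsub>M\<^esub> y}" if "(x, x') \<in> r" "(y, y') \<in> r" for x' y'
      using equiv_class_eq[OF r'(1) r'(2)[OF that]] by simp
    then have "(\<Union>x'\<in>r `` {x}. \<Union>y'\<in>r `` {y}. r `` {x' \<oplus>\<^bsub>M\<^esub> y'}) =
        (\<Union>x'\<in>r `` {x}. \<Union>y'\<in>r `` {y}. r `` {x \<oplus>\<^bsub>M\<^esub> y})"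
      by (intro SUP_cong refl) simp
    \<comment> \<open>The union over representatives is now a union of one constant set; it equals
      that set because the index sets are nonempty.\<close>
    moreover have "x \<in> r `` {x}" "y \<in> r `` {y}"
      using that equiv_class_self[OF r'(1)] by blast+
    ultimately show ?thesis
      by (auto simp: tmod_quot_def)
  qed
  show "a \<odot>\<^bsub>tmod_quot M r\<^esub> r `` {x} = r `` {a \<odot>\<^bsub>M\<^esub> x}" if "x \<in> carrier M"
  proof -
    have "r `` {a \<odot>\<^bsub>M\<^esub> x'} = r `` {a \<odot>\<^bsub>M\<^esub> x}" if "(x, x') \<in> r" for x'
      using equiv_class_eq[OF r'(1) r'(3)[OF that]] by simp
    then have "(\<Union>x'\<in>r `` {x}. r `` {a \<odot>\<^bsub>M\<^esub> x'}) = (\<Union>x'\<in>r `` {x}. r `` {a \<odot>\<^bsub>M\<^esub> x})"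
      by (intro SUP_cong refl) simp
    moreover have "x \<in> r `` {x}"
      using that equiv_class_self[OF r'(1)] by blast
    ultimately show ?thesis
      by (auto simp: tmod_quot_def)
  qed
qed

lemma carrier_tmod_quot: "carrier (tmod_quot M r) = carrier M // r"
  and zero_tmod_quot: "\<zero>\<^bsub>tmod_quot M r\<^esub> = r `` {\<zero>\<^bsub>M\<^esub>}"
  by (simp_all add: tmod_quot_def)

lemma tmodule_tmod_quot:
  assumes M: "tmodule M" and r: "tmod_congruence M r"
  shows "tmodule (tmod_quot M r)"
proof -
  interpret M: tmodule M by fact
  note q = tmod_quot_class[OF M r] carrier_tmod_quot zero_tmod_quot
  show ?thesis
  proof (rule tmodule.intro)
    show "abelian_monoid (tmod_quot M r)"
      by (rule abelian_monoidI)
        (auto simp: q quotientI M.a_assoc M.a_comm M.a_lcomm elim!: quotientE)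
    show "tmodule_axioms (tmod_quot M r)"
      by unfold_locales
        (auto simp: q quotientI M.smult_closed M.smult_l_distr M.smult_r_distr M.smult_assoc
          M.smult_one M.smult_l_zero M.smult_r_zero elim!: quotientE)
  qed
qed

lemma tmod_hom_quotI:
  assumes M: "tmodule M" and r: "tmod_congruence M r"
    and ext: "F \<in> extensional (carrier (tmod_quot M r))"
    and F: "\<And>x. x \<in> carrier M \<Longrightarrow> F (r `` {x}) = h x"
    and closed: "\<And>x. x \<in> carrier M \<Longrightarrow> h x \<in> carrier N"
    and add: "\<And>x y. x \<in> carrier M \<Longrightarrow> y \<in> carrier M \<Longrightarrow> h (x \<oplus>\<^bsub>M\<^esub> y) = h x \<oplus>\<^bsub>N\<^esub> h y"
    and zero: "h \<zero>\<^bsub>M\<^esub> = \<zero>\<^bsub>N\<^esub>"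
    and smult: "\<And>a x. x \<in> carrier M \<Longrightarrow> h (a \<odot>\<^bsub>M\<^esub> x) = a \<odot>\<^bsub>N\<^esub> h x"
  shows "F \<in> tmod_hom (tmod_quot M r) N"
proof -
  note cl = tmodule_tmod_closed[OF M]
  note q = tmod_quot_class[OF M r] carrier_tmod_quot zero_tmod_quot
  show ?thesis
    by (rule tmod_homI) (use ext in \<open>auto simp: q F cl closed add zero smult elim!: quotientE\<close>)
qed

text \<open>The universal property of the quotient: evaluate \<open>h\<close> at a chosen
  representative; by \<open>resp\<close> the choice does not affect the value.\<close>

lemma tmod_quot_lift:
  assumes M: "tmodule M" and r: "tmod_congruence M r"
    and resp: "\<And>x y. (x, y) \<in> r \<Longrightarrow> h x = h y"
    and closed: "\<And>x. x \<in> carrier M \<Longrightarrow> h x \<in> carrier N"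
    and add: "\<And>x y. x \<in> carrier M \<Longrightarrow> y \<in> carrier M \<Longrightarrow> h (x \<oplus>\<^bsub>M\<^esub> y) = h x \<oplus>\<^bsub>N\<^esub> h y"
    and zero: "h \<zero>\<^bsub>M\<^esub> = \<zero>\<^bsub>N\<^esub>"
    and smult: "\<And>a x. x \<in> carrier M \<Longrightarrow> h (a \<odot>\<^bsub>M\<^esub> x) = a \<odot>\<^bsub>N\<^esub> h x"
  obtains F where "F \<in> tmod_hom (tmod_quot M r) N"
    and "\<And>x. x \<in> carrier M \<Longrightarrow> F (r `` {x}) = h x"
proof -
  define F where "F = (\<lambda>X\<in>carrier (tmod_quot M r). h (SOME x. x \<in> X))"
  have F: "F (r `` {x}) = h x" if x: "x \<in> carrier M" for x
  proof -
    have "x \<in> r `` {x}" using equiv_class_self[OF tmod_congruenceD(1)[OF r] x] .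
    then have "(SOME y. y \<in> r `` {x}) \<in> r `` {x}" by (rule someI)
    then have "h x = h (SOME y. y \<in> r `` {x})" by (intro resp) blast
    then show ?thesis using x by (simp add: F_def carrier_tmod_quot quotientI)
  qed
  have "F \<in> extensional (carrier (tmod_quot M r))"
    unfolding F_def by (rule restrict_extensional)
  then have "F \<in> tmod_hom (tmod_quot M r) N"
    by (rule tmod_hom_quotI[OF M r _ F closed add zero smult])
  then show thesis using F by (rule that)
qed


section \<open>Free modules\<close>

lemma lookup_scalar_mult [simp]:
  "Poly_Mapping.lookup (scalar_mult c f) s = c * Poly_Mapping.lookup f s"
  by (simp add: scalar_mult_def map.rep_eq when_def)

text \<open>Indices outside the support contribute zero. The larger index set matters when the
  support can shrink, as under multiplication by a scalar.\<close>

lemma push_superset: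
  assumes "finite A" "Poly_Mapping.keys f \<subseteq> A"
  shows "push \<phi> f = (\<Sum>s\<in>A. Poly_Mapping.single (\<phi> s) (Poly_Mapping.lookup f s))"
  unfolding push_def by (rule sum.mono_neutral_left) (use assms in \<open>auto simp: in_keys_iff\<close>)

lemma push_zero [simp]: "push \<phi> 0 = 0"
  by (simp add: push_def)

lemma push_single [simp]: "push \<phi> (Poly_Mapping.single s c) = Poly_Mapping.single (\<phi> s) c"
  by (subst push_superset[of "{s}"]) (auto simp: lookup_single)

lemma push_add: "push \<phi> (f + g) = push \<phi> f + push \<phi> g"
  unfolding push_def
  by (rule setsum_keys_plus_distrib) (simp_all add: single_add)

lemma push_sum: "push \<phi> (\<Sum>i\<in>I. f i) = (\<Sum>i\<in>I. push \<phi> (f i))"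
  by (induction I rule: infinite_finite_induct) (simp_all add: push_add)

lemma push_scalar_mult:
  fixes f :: "'s \<Rightarrow>\<^sub>0 'c::semiring_0"
  shows "push \<phi> (scalar_mult c f) = scalar_mult c (push \<phi> f)"
proof -
  have "push \<phi> (scalar_mult c f) =
      (\<Sum>s\<in>Poly_Mapping.keys f. Poly_Mapping.single (\<phi> s) (c * Poly_Mapping.lookup f s))"
    by (subst push_superset[of "Poly_Mapping.keys f"]) (auto simp: in_keys_iff)
  also have "\<dots> = scalar_mult c (push \<phi> f)"
    by (rule poly_mapping_eqI)
      (simp add: push_def lookup_sum lookup_single when_def sum_distrib_left mult.assoc
        if_distrib cong: if_cong)
  finally show ?thesis .
qed

lemma push_push: "push \<psi> (push \<phi> f) = push (\<lambda>s. \<psi> (\<phi> s)) f"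
  by (simp add: push_def[of \<phi>] push_sum) (simp add: push_def)

lemma push_cong:
  "f \<in> free_carrier S \<Longrightarrow> (\<And>s. s \<in> S \<Longrightarrow> \<phi> s = \<psi> s) \<Longrightarrow> push \<phi> f = push \<psi> f"
  unfolding push_def free_carrier_def by (rule sum.cong) auto

lemma push_ident: "push (\<lambda>s. s) f = f"
  by (rule poly_mapping_eqI)
    (simp add: push_def lookup_sum lookup_single when_def in_keys_iff sum.If_cases)

lemma push_id_on: "f \<in> free_carrier S \<Longrightarrow> (\<And>s. s \<in> S \<Longrightarrow> \<phi> s = s) \<Longrightarrow> push \<phi> f = f"
  using push_cong[of f S \<phi> "\<lambda>s. s"] by (simp add: push_ident)

lemma keys_push: "Poly_Mapping.keys (push \<phi> f) \<subseteq> \<phi> ` Poly_Mapping.keys f"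
  unfolding push_def by (rule order_trans[OF keys_sum]) (auto split: if_splits)

lemma push_free_carrier:
  "f \<in> free_carrier S \<Longrightarrow> \<phi> ` S \<subseteq> T \<Longrightarrow> push \<phi> f \<in> free_carrier T"
  unfolding free_carrier_def mem_Collect_eq by (meson keys_push image_mono order_trans)

lemma free_carrier_closed:
  shows "0 \<in> free_carrier S"
    and "f \<in> free_carrier S \<Longrightarrow> g \<in> free_carrier S \<Longrightarrow> f + g \<in> free_carrier S"
    and "f \<in> free_carrier S \<Longrightarrow> scalar_mult c f \<in> free_carrier S"
    and "s \<in> S \<Longrightarrow> Poly_Mapping.single s d \<in> free_carrier S"
    and "f \<in> free_carrier S \<Longrightarrow> Poly_Mapping.update t 0 f \<in> free_carrier S"
  using keys_add[of f g]
  by (auto simp: free_carrier_def keys_update split: if_splits) (force simp: in_keys_iff)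

lemma free_carrier_UNIV [simp]: "free_carrier UNIV = UNIV"
  by (simp add: free_carrier_def)

lemma free_tmod_simps [simp]:
  "carrier (free_tmod S) = free_carrier S" "\<zero>\<^bsub>free_tmod S\<^esub> = 0"
  "f \<oplus>\<^bsub>free_tmod S\<^esub> g = f + g" "c \<odot>\<^bsub>free_tmod S\<^esub> f = scalar_mult c f"
  by (simp_all add: free_tmod_def)

lemma tmodule_free_tmod: "tmodule (free_tmod S)"
proof (rule tmodule.intro)
  show "abelian_monoid (free_tmod S)"
    by (rule abelian_monoidI) (simp_all add: free_carrier_closed ac_simps)
  show "tmodule_axioms (free_tmod S)"
    by unfold_locales
      (auto simp: free_carrier_closed lookup_add algebra_simps intro!: poly_mapping_eqI)
qed

text \<open>A linear map is determined by its values on the basis elements, since each vector is a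
  finite combination of them.\<close>

lemma free_linear_sum:
  fixes q :: "('s \<Rightarrow>\<^sub>0 'k::field) \<Rightarrow> 'v::ab_group_add"
  assumes add: "\<And>f g. f \<in> free_carrier S \<Longrightarrow> g \<in> free_carrier S \<Longrightarrow> q (f + g) = q f + q g"
    and scale: "\<And>c f. f \<in> free_carrier S \<Longrightarrow> q (scalar_mult c f) = scale c (q f)"
    and f: "f \<in> free_carrier S"
  shows "q f = (\<Sum>s\<in>Poly_Mapping.keys f.
    scale (Poly_Mapping.lookup f s) (q (Poly_Mapping.single s 1)))"
proof -
  have q0: "q 0 = 0" using add[of 0 0] by (simp add: free_carrier_closed)
  \<comment> \<open>Membership is carried along in the induction because additivity of
    \<open>q\<close> is only given on \<open>free_carrier S\<close>.\<close>
  have *: "(\<Sum>s\<in>A. Poly_Mapping.single s (Poly_Mapping.lookup f s)) \<in> free_carrier S \<and>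
      q (\<Sum>s\<in>A. Poly_Mapping.single s (Poly_Mapping.lookup f s)) =
      (\<Sum>s\<in>A. scale (Poly_Mapping.lookup f s) (q (Poly_Mapping.single s 1)))"
    if "finite A" "A \<subseteq> S" for A
    using that
  proof (induction A)
    case empty
    then show ?case by (simp add: q0 free_carrier_closed)
  next
    case (insert s A)
    have "Poly_Mapping.single s (Poly_Mapping.lookup f s) =
        scalar_mult (Poly_Mapping.lookup f s) (Poly_Mapping.single s (1::'k))"
      by (rule poly_mapping_eqI) (simp add: lookup_single when_def)
    then have "q (Poly_Mapping.single s (Poly_Mapping.lookup f s)) =
        scale (Poly_Mapping.lookup f s) (q (Poly_Mapping.single s 1))"
      using insert.prems by (simp add: scale free_carrier_closed)
    then show ?case using insert by (simp add: add free_carrier_closed)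
  qed
  have "(\<Sum>s\<in>Poly_Mapping.keys f. Poly_Mapping.single s (Poly_Mapping.lookup f s)) = f"
    using push_ident[of f] by (simp add: push_def)
  then show ?thesis
    using *[of "Poly_Mapping.keys f"] f by (simp add: free_carrier_def)
qed


section \<open>Valuations and bend relations\<close>

lemma tropical_add_eq_min: "(a::tropical) + b = min a b"
  by (rule plus_tropical_def)

lemma tropical_le_zero: "(a::tropical) \<le> 0"
  by (cases a) (simp_all add: zero_tropical_def)

context
  fixes v :: "'k::field \<Rightarrow> tropical"
  assumes v: "valuation v"
begin

lemma valuation_eq_0_iff: "v a = 0 \<longleftrightarrow> a = 0"
  using v by (simp add: valuation_def zero_tropical_def)

lemma valuation_mult: "v (a * b) = v a * v b"
  using v by (simp add: valuation_def)

lemma valuation_add: "min (v a) (v b) \<le> v (a + b)"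
  using v by (simp add: valuation_def)

text \<open>Both \<open>v 1\<close> and \<open>v (- 1)\<close> are real numbers: the first satisfies
  x + x = x, and the double of the second is \<open>v 1\<close>, so both are the real number zero,
  the tropical \<open>1\<close>.\<close>

lemma valuation_minus: "v (- a) = v a"
proof -
  have "v 1 = 1"
  proof (cases "v 1")
    case (TReal x)
    then show ?thesis using valuation_mult[of 1 1] by (simp add: one_tropical_def)
  qed (use v in \<open>simp add: valuation_def\<close>)
  then have "v (- 1) = 1"
    using valuation_mult[of "- 1" "- 1"]
    by (cases "v (- 1)") (simp_all add: one_tropical_def)
  then show ?thesis using valuation_mult[of "- 1" a] by simp
qed

text \<open>Write a as (a + b) + (- b): the minimum of \<open>v (a + b)\<close> and
  \<open>v b\<close> is at most \<open>v a\<close>, and it cannot be \<open>v b\<close>.\<close>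

lemma valuation_add_less:
  assumes "v a < v b"
  shows "v (a + b) = v a"
proof (rule antisym)
  show "v a \<le> v (a + b)" using valuation_add[of a b] assms by (simp add: min_def less_imp_le)
  show "v (a + b) \<le> v a"
    using valuation_add[of "a + b" "- b"] assms by (auto simp: valuation_minus min_def split: if_splits)
qed

lemma lookup_trop [simp]: "Poly_Mapping.lookup (trop v f) s = v (Poly_Mapping.lookup f s)"
  using valuation_eq_0_iff[of 0] by (simp add: trop_def map.rep_eq when_def)

lemma keys_trop [simp]: "Poly_Mapping.keys (trop v f) = Poly_Mapping.keys f"
  by (auto simp: in_keys_iff valuation_eq_0_iff)

lemma trop_free_carrier: "f \<in> free_carrier S \<Longrightarrow> trop v f \<in> free_carrier S"
  by (simp add: free_carrier_def)

lemma sum_valuation_le: "(\<Sum>i\<in>I. v (c i)) \<le> v (\<Sum>i\<in>I. c i)"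
proof (induction I rule: infinite_finite_induct)
  case (insert i I)
  have "min (v (c i)) (\<Sum>i\<in>I. v (c i)) \<le> min (v (c i)) (v (\<Sum>i\<in>I. c i))"
    using insert.IH by (rule min.mono[OF order_refl])
  also have "\<dots> \<le> v (c i + (\<Sum>i\<in>I. c i))" by (rule valuation_add)
  finally show ?case using insert.hyps by (simp add: tropical_add_eq_min)
qed (simp_all add: valuation_eq_0_iff[THEN iffD2])

text \<open>The ultrametric inequality over the fibre of \<phi> above t. It can be strict, when
  coefficients cancel in the fibre.\<close>

lemma push_trop_le:
  "Poly_Mapping.lookup (push \<phi> (trop v f)) t \<le> v (Poly_Mapping.lookup (push \<phi> f) t)"
proof -
  have "(\<Sum>s\<in>Poly_Mapping.keys f. v (Poly_Mapping.lookup f s) when \<phi> s = t) =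
      (\<Sum>s\<in>Poly_Mapping.keys f. v (Poly_Mapping.lookup f s when \<phi> s = t))"
    by (rule sum.cong) (auto simp: when_def valuation_eq_0_iff[THEN iffD2])
  then show ?thesis
    using sum_valuation_le[of "\<lambda>s. Poly_Mapping.lookup f s when \<phi> s = t" "Poly_Mapping.keys f"]
    by (simp add: push_def lookup_sum lookup_single)
qed

section \<open>The bend congruence of a kernel\<close>

lemma bend_relations_subset:
  "bend_relations (trop v ` ker_on S q) \<subseteq> free_carrier S \<times> free_carrier S"
  by (auto simp: bend_relations_def ker_on_def trop_free_carrier free_carrier_closed)

lemma trop_congruence_congruence: "tmod_congruence (free_tmod S) (trop_congruence v S q)"
  unfolding trop_congruence_def bend_congruence_def
  by (rule tmod_congruence_gen_congruence[OF tmodule_free_tmod])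
    (use bend_relations_subset in simp)

lemma trop_congruence_equiv: "equiv (free_carrier S) (trop_congruence v S q)"
  using tmod_congruenceD(1)[OF trop_congruence_congruence] by simp

lemma trop_congruence_bend:
  assumes "f \<in> free_carrier S" "q f = 0" "t \<in> Poly_Mapping.keys f"
  shows "(trop v f, Poly_Mapping.update t 0 (trop v f)) \<in> trop_congruence v S q"
proof -
  have "(trop v f, Poly_Mapping.update t 0 (trop v f)) \<in> bend_relations (trop v ` ker_on S q)"
    using assms by (auto simp: bend_relations_def ker_on_def)
  then show ?thesis
    unfolding trop_congruence_def bend_congruence_def
    using tmod_congruence_gen_superset by blast
qed

text \<open>
  If \<open>\<phi>\<close> is not injective, \<open>push \<phi> (trop v f)\<close> differs from \<open>trop v (push \<phi> f)\<close>.
  When the deleted term is the strict minimum of its fibre, no cancellation occurs at \<open>\<phi> t\<close>, and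
  the wanted relation is the bend relation of \<open>trop v (push \<phi> f)\<close> at \<open>\<phi> t\<close>
  with the image of the other terms added on both sides; otherwise the two sides coincide.
\<close>

lemma push_bend:
  assumes f: "f \<in> free_carrier S" and \<phi>: "\<phi> ` S \<subseteq> T"
    and ker: "p (push \<phi> f) = 0" and t: "t \<in> Poly_Mapping.keys f"
  shows "(push \<phi> (trop v f), push \<phi> (Poly_Mapping.update t 0 (trop v f))) \<in> trop_congruence v T p"
proof -
  define f' where "f' = Poly_Mapping.update t 0 f"
  define c where "c = Poly_Mapping.lookup f t"
  define G where "G = push \<phi> (trop v f')"
  define u where "u = \<phi> t"
  let ?h = "trop v (push \<phi> f)"
  have f_eq: "f = Poly_Mapping.single t c + f'"
    by (rule poly_mapping_eqI) (auto simp: f'_def c_def lookup_add lookup_single lookup_update when_def)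
  have upd: "Poly_Mapping.update t 0 (trop v f) = trop v f'"
    by (rule poly_mapping_eqI) (auto simp: f'_def lookup_update valuation_eq_0_iff[THEN iffD2])
  have "trop v f = Poly_Mapping.single t (v c) + trop v f'"
    by (rule poly_mapping_eqI)
      (auto simp: f'_def c_def lookup_add lookup_single lookup_update when_def
        valuation_eq_0_iff[THEN iffD2])
  then have lhs: "push \<phi> (trop v f) = Poly_Mapping.single u (v c) + G"
    by (simp add: push_add G_def u_def)
  have "f' \<in> free_carrier S" unfolding f'_def by (rule free_carrier_closed(5)[OF f])
  then have G: "G \<in> free_carrier T"
    unfolding G_def by (rule push_free_carrier[OF trop_free_carrier \<phi>])
  then have refl: "(G, G) \<in> trop_congruence v T p"
    using trop_congruence_equiv by (auto simp: equiv_def refl_on_def)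
  show ?thesis
  proof (cases "Poly_Mapping.lookup G u \<le> v c")
    case True
    have "Poly_Mapping.single u (v c) + G = G"
    proof (rule poly_mapping_eqI)
      fix w show "Poly_Mapping.lookup (Poly_Mapping.single u (v c) + G) w = Poly_Mapping.lookup G w"
        using True by (cases "w = u") (simp_all add: lookup_add lookup_single tropical_add_eq_min
            min_absorb2 tropical_le_zero)
    qed
    then show ?thesis using refl by (simp add: lhs upd G_def)
  next
    case False
    have push_f: "push \<phi> f = Poly_Mapping.single u c + push \<phi> f'"
      by (subst f_eq) (simp add: push_add u_def)
    have le: "Poly_Mapping.lookup G w \<le> v (Poly_Mapping.lookup (push \<phi> f') w)" for w
      unfolding G_def by (rule push_trop_le)
    \<comment> \<open>Here \<open>v c\<close> is strictly below the coefficient of \<open>G\<close>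
      at u, hence below the valuation of the coefficient to which c is added, so c dominates the
      sum.\<close>
    have h_u: "Poly_Mapping.lookup ?h u = v c"
      using False le[of u] by (simp add: push_f lookup_add valuation_add_less)
    have h_w: "Poly_Mapping.lookup ?h w = v (Poly_Mapping.lookup (push \<phi> f') w)" if "w \<noteq> u" for w
      using that by (simp add: push_f lookup_add lookup_single)
    have "v c \<noteq> 0" using t by (simp add: c_def in_keys_iff valuation_eq_0_iff)
    then have "u \<in> Poly_Mapping.keys ?h" unfolding in_keys_iff h_u .
    then have "u \<in> Poly_Mapping.keys (push \<phi> f)" by simp
    then have "(?h, Poly_Mapping.update u 0 ?h) \<in> trop_congruence v T p"
      by (intro trop_congruence_bend push_free_carrier[OF f \<phi>] ker)
    \<comment> \<open>Away from u the coefficients of \<open>G\<close> are at most those of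
      \<open>?h\<close>, so adding \<open>G\<close> absorbs all of \<open>?h\<close> except its term
      at u.\<close>
    then have "(?h + G, Poly_Mapping.update u 0 ?h + G) \<in> trop_congruence v T p"
      using tmod_congruenceD(2)[OF trop_congruence_congruence _ refl] by simp
    moreover have "?h + G = Poly_Mapping.single u (v c) + G"
    proof (rule poly_mapping_eqI)
      fix w show "Poly_Mapping.lookup (?h + G) w = Poly_Mapping.lookup (Poly_Mapping.single u (v c) + G) w"
        using le[of w] h_u h_w[of w]
        by (cases "w = u")
          (simp_all add: lookup_add lookup_single tropical_add_eq_min min_absorb2 tropical_le_zero)
    qed
    moreover have "Poly_Mapping.update u 0 ?h + G = G"
    proof (rule poly_mapping_eqI)
      fix w show "Poly_Mapping.lookup (Poly_Mapping.update u 0 ?h + G) w = Poly_Mapping.lookup G w"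
        using le[of w] h_w[of w]
        by (cases "w = u")
          (simp_all add: lookup_add lookup_update tropical_add_eq_min min_absorb2 tropical_le_zero)
    qed
    ultimately show ?thesis by (simp add: lhs upd G_def)
  qed
qed

text \<open>The induction principle for the bend congruence, phrased with kernel vectors over the
  field.\<close>

lemma trop_congruence_least:
  assumes s: "tmod_congruence (free_tmod S) s"
    and bend: "\<And>f t. f \<in> free_carrier S \<Longrightarrow> q f = 0 \<Longrightarrow> t \<in> Poly_Mapping.keys f \<Longrightarrow>
      (trop v f, Poly_Mapping.update t 0 (trop v f)) \<in> s"
  shows "trop_congruence v S q \<subseteq> s"
  unfolding trop_congruence_def bend_congruence_def
  by (rule tmod_congruence_gen_least[OF s]) (auto simp: bend_relations_def ker_on_def bend)

end


section \<open>The tropicalization as a functor\<close>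

abbreviation trop_class ::
    "('k::zero \<Rightarrow> tropical) \<Rightarrow> 's set \<Rightarrow> (('s \<Rightarrow>\<^sub>0 'k) \<Rightarrow> 'v::zero)
      \<Rightarrow> ('s \<Rightarrow>\<^sub>0 tropical) \<Rightarrow> ('s \<Rightarrow>\<^sub>0 tropical) set" where
  "trop_class v S q f \<equiv> trop_congruence v S q `` {f}"

text \<open>A morphism of presentations, with no finiteness of the index sets and no extensionality
  of \<phi>, so that the maps to the canonical presentation on all of V fall under the same notion
  as the arrows between finite presentations.\<close>

definition presentation_map ::
    "'s set \<Rightarrow> (('s \<Rightarrow>\<^sub>0 'k::comm_monoid_add) \<Rightarrow> 'v) \<Rightarrow> 't set \<Rightarrow> (('t \<Rightarrow>\<^sub>0 'k) \<Rightarrow> 'v)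
      \<Rightarrow> ('s \<Rightarrow> 't) \<Rightarrow> bool" where
  "presentation_map S q T p \<phi> \<longleftrightarrow>
     \<phi> ` S \<subseteq> T \<and> (\<forall>f\<in>free_carrier S. p (push \<phi> f) = q f)"

lemma presentation_map_cong:
  assumes "\<And>s. s \<in> S \<Longrightarrow> \<phi> s = \<psi> s"
  shows "presentation_map S q T p \<phi> \<longleftrightarrow> presentation_map S q T p \<psi>"
  using assms
  by (auto simp: presentation_map_def image_subset_iff push_cong[OF _ assms])

lemma presentation_map_compose:
  fixes q :: "('s \<Rightarrow>\<^sub>0 'k::comm_monoid_add) \<Rightarrow> 'v"
  assumes "presentation_map S q T p \<phi>" "presentation_map T p U r \<psi>"
  shows "presentation_map S q U r (\<lambda>s. \<psi> (\<phi> s))"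
proof -
  have "push \<phi> f \<in> free_carrier T" if "f \<in> free_carrier S" for f :: "'s \<Rightarrow>\<^sub>0 'k"
    by (rule push_free_carrier[OF that]) (use assms(1) in \<open>simp add: presentation_map_def\<close>)
  then show ?thesis
    using assms by (auto simp: presentation_map_def push_push[symmetric] image_subset_iff)
qed

context
  fixes v :: "'k::field \<Rightarrow> tropical"
  assumes v: "valuation v"
begin

section \<open>Classes and the maps induced by morphisms of presentations\<close>

lemma carrier_tropicalization:
  "carrier (tropicalization v S q) = free_carrier S // trop_congruence v S q"
  by (simp add: tropicalization_def carrier_tmod_quot)

lemma trop_class_closed:
  "f \<in> free_carrier S \<Longrightarrow> trop_class v S q f \<in> carrier (tropicalization v S q)"
  by (simp add: carrier_tropicalization quotientI)

lemma trop_class_cases: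
  assumes "X \<in> carrier (tropicalization v S q)"
  obtains f where "f \<in> free_carrier S" "X = trop_class v S q f"
  using assms by (auto simp: carrier_tropicalization elim: quotientE)

lemma tropicalization_simps:
  shows "f \<in> free_carrier S \<Longrightarrow> g \<in> free_carrier S \<Longrightarrow>
      trop_class v S q f \<oplus>\<^bsub>tropicalization v S q\<^esub> trop_class v S q g = trop_class v S q (f + g)"
    and "f \<in> free_carrier S \<Longrightarrow>
      c \<odot>\<^bsub>tropicalization v S q\<^esub> trop_class v S q f = trop_class v S q (scalar_mult c f)"
    and "\<zero>\<^bsub>tropicalization v S q\<^esub> = trop_class v S q 0"
  using tmod_quot_class[OF tmodule_free_tmod trop_congruence_congruence[OF v], of _ S]
  by (simp_all add: tropicalization_def zero_tmod_quot)

lemma tmodule_tropicalization: "tmodule (tropicalization v S q)"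
  unfolding tropicalization_def
  by (rule tmodule_tmod_quot[OF tmodule_free_tmod trop_congruence_congruence[OF v]])

lemma trop_class_eq:
  "(f, g) \<in> trop_congruence v S q \<Longrightarrow> trop_class v S q f = trop_class v S q g"
  by (rule equiv_class_eq[OF trop_congruence_equiv[OF v]])

lemma extensional_tropicalization_eqI:
  assumes "F \<in> extensional (carrier (tropicalization v S q))"
    and "G \<in> extensional (carrier (tropicalization v S q))"
    and "\<And>f. f \<in> free_carrier S \<Longrightarrow> F (trop_class v S q f) = G (trop_class v S q f)"
  shows "F = G"
  by (rule extensionalityI[OF assms(1,2)]) (auto elim!: trop_class_cases simp: assms(3))

text \<open>Pull the target congruence back along \<open>push \<phi>\<close>. A morphism takes the
  kernel of q to the kernel of p, so \<open>push_bend\<close> puts every bend relation into the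
  pullback.\<close>

lemma push_trop_congruence:
  assumes \<phi>: "presentation_map S q T p \<phi>" and fg: "(f, g) \<in> trop_congruence v S q"
  shows "(push \<phi> f, push \<phi> g) \<in> trop_congruence v T p"
proof -
  let ?s = "{(f, g) \<in> free_carrier S \<times> free_carrier S. (push \<phi> f, push \<phi> g) \<in> trop_congruence v T p}"
  have im: "\<phi> ` S \<subseteq> T" using \<phi> by (simp add: presentation_map_def)
  have "tmod_congruence (free_tmod S) ?s"
    using tmod_congruence_pullback[OF tmodule_free_tmod trop_congruence_congruence[OF v],
        of S "push \<phi>" T p]
    by (simp add: push_add push_scalar_mult push_free_carrier[OF _ im])
  then have "trop_congruence v S q \<subseteq> ?s"
  proof (rule trop_congruence_least[OF v])
    fix f t assume f: "f \<in> free_carrier S" "q f = 0" "t \<in> Poly_Mapping.keys f"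
    then have "p (push \<phi> f) = 0" using \<phi> by (simp add: presentation_map_def)
    then show "(trop v f, Poly_Mapping.update t 0 (trop v f)) \<in> ?s"
      using push_bend[where \<phi>=\<phi> and p=p, OF v f(1) im _ f(3)] f(1)
      by (simp add: trop_free_carrier[OF v] free_carrier_closed)
  qed
  then show ?thesis using fg by blast
qed

lemma trop_map_class:
  assumes \<phi>: "presentation_map S q T p \<phi>" and f: "f \<in> free_carrier S"
  shows "trop_map v S q T p \<phi> (trop_class v S q f) = trop_class v T p (push \<phi> f)"
proof -
  have "(\<lambda>g. trop_class v T p (push \<phi> g)) respects trop_congruence v S q"
    by (rule congruentI) (rule trop_class_eq[OF push_trop_congruence[OF \<phi>]])
  then show ?thesis
    using UN_equiv_class[OF trop_congruence_equiv[OF v] _ f]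
    by (simp add: trop_map_def trop_class_closed[OF f])
qed

lemma trop_map_generator:
  assumes "presentation_map S q T p \<phi>" "s \<in> S"
  shows "trop_map v S q T p \<phi> (trop_generator v S q s) = trop_generator v T p (\<phi> s)"
  using trop_map_class[OF assms(1)] assms(2) by (simp add: trop_generator_def free_carrier_closed)

lemma trop_map_extensional:
  "trop_map v S q T p \<phi> \<in> extensional (carrier (tropicalization v S q))"
  by (simp add: trop_map_def)

lemma trop_map_hom:
  assumes \<phi>: "presentation_map S q T p \<phi>"
  shows "trop_map v S q T p \<phi> \<in> tmod_hom (tropicalization v S q) (tropicalization v T p)"
proof -
  have push: "f \<in> free_carrier S \<Longrightarrow> push \<phi> f \<in> free_carrier T" for f :: "_ \<Rightarrow>\<^sub>0 tropical"
    using \<phi> by (intro push_free_carrier) (auto simp: presentation_map_def)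
  have "trop_map v S q T p \<phi>
      \<in> tmod_hom (tmod_quot (free_tmod S) (trop_congruence v S q)) (tropicalization v T p)"
  proof (rule tmod_hom_quotI[OF tmodule_free_tmod trop_congruence_congruence[OF v],
        where h="\<lambda>f. trop_class v T p (push \<phi> f)"])
    show "trop_map v S q T p \<phi>
        \<in> extensional (carrier (tmod_quot (free_tmod S) (trop_congruence v S q)))"
      using trop_map_extensional[of S q] by (simp only: tropicalization_def)
    show "trop_class v T p (push \<phi> \<zero>\<^bsub>free_tmod S\<^esub>) = \<zero>\<^bsub>tropicalization v T p\<^esub>"
      by (simp add: tropicalization_simps(3))
  next
    fix f assume "f \<in> carrier (free_tmod S)"
    then have f: "f \<in> free_carrier S" by simp
    show "trop_map v S q T p \<phi> (trop_class v S q f) = trop_class v T p (push \<phi> f)"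
      by (rule trop_map_class[OF \<phi> f])
    show "trop_class v T p (push \<phi> f) \<in> carrier (tropicalization v T p)"
      by (rule trop_class_closed[OF push[OF f]])
    show "trop_class v T p (push \<phi> (c \<odot>\<^bsub>free_tmod S\<^esub> f)) =
        c \<odot>\<^bsub>tropicalization v T p\<^esub> trop_class v T p (push \<phi> f)" for c
      by (simp add: push_scalar_mult tropicalization_simps(2)[OF push[OF f]])
    fix g assume "g \<in> carrier (free_tmod S)"
    then have g: "g \<in> free_carrier S" by simp
    show "trop_class v T p (push \<phi> (f \<oplus>\<^bsub>free_tmod S\<^esub> g)) =
        trop_class v T p (push \<phi> f) \<oplus>\<^bsub>tropicalization v T p\<^esub> trop_class v T p (push \<phi> g)"
      by (simp add: push_add tropicalization_simps(1)[OF push[OF f] push[OF g]])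
  qed
  then show ?thesis by (simp only: tropicalization_def)
qed

text \<open>The composite index map is prescribed only on \<open>S\<close>, which covers both the
  restricted composites in the category and the unrestricted maps to V in the cocone.\<close>

lemma trop_map_compose:
  assumes \<phi>: "presentation_map S q T p \<phi>" and \<psi>: "presentation_map T p U r \<psi>"
    and \<chi>: "\<And>s. s \<in> S \<Longrightarrow> \<chi> s = \<psi> (\<phi> s)"
  shows "trop_map v S q U r \<chi> =
    compose (carrier (tropicalization v S q)) (trop_map v T p U r \<psi>) (trop_map v S q T p \<phi>)"
proof (rule extensional_tropicalization_eqI[OF trop_map_extensional compose_extensional])
  fix f :: "_ \<Rightarrow>\<^sub>0 tropical" assume f: "f \<in> free_carrier S"
  have "presentation_map S q U r \<chi>"
    using presentation_map_compose[OF \<phi> \<psi>]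
      presentation_map_cong[of S \<chi> "\<lambda>s. \<psi> (\<phi> s)" q U r] \<chi> by simp
  moreover have "push \<phi> f \<in> free_carrier T"
    using \<phi> f by (intro push_free_carrier) (auto simp: presentation_map_def)
  moreover have "push \<chi> f = push \<psi> (push \<phi> f)"
    using push_cong[OF f \<chi>] by (simp add: push_push)
  ultimately show "trop_map v S q U r \<chi> (trop_class v S q f) =
      compose (carrier (tropicalization v S q)) (trop_map v T p U r \<psi>) (trop_map v S q T p \<phi>)
        (trop_class v S q f)"
    using f by (simp add: compose_eq trop_class_closed trop_map_class[OF \<phi>] trop_map_class[OF \<psi>]
        trop_map_class)
qed

lemma trop_map_id:
  assumes "\<And>s. s \<in> S \<Longrightarrow> \<phi> s = s"
  shows "trop_map v S q S q \<phi> = (\<lambda>X\<in>carrier (tropicalization v S q). X)"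
proof (rule extensional_tropicalization_eqI[OF trop_map_extensional restrict_extensional])
  fix f :: "_ \<Rightarrow>\<^sub>0 tropical" assume f: "f \<in> free_carrier S"
  have "presentation_map S q S q \<phi>"
    using assms by (auto simp: presentation_map_def push_id_on)
  then show "trop_map v S q S q \<phi> (trop_class v S q f) =
      (\<lambda>X\<in>carrier (tropicalization v S q). X) (trop_class v S q f)"
    using f assms by (simp add: trop_map_class trop_class_closed push_id_on)
qed

end


section \<open>Finite presentations and their colimit\<close>

lemma Obj_finite_presentations [simp]:
  "(E, q) \<in> Obj (finite_presentations scale) \<longleftrightarrow> finite E \<and> free_linear_surj scale E q"
  by (simp add: finite_presentations_def)

lemma Mor_finite_presentations [simp]:
  "\<phi> \<in> Mor (finite_presentations scale) (E\<^sub>1, q\<^sub>1) (E\<^sub>2, q\<^sub>2) \<longleftrightarrow>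
     \<phi> \<in> extensional E\<^sub>1 \<and> presentation_map E\<^sub>1 q\<^sub>1 E\<^sub>2 q\<^sub>2 \<phi>"
  by (auto simp: finite_presentations_def presentation_map_def PiE_def)

lemma Idn_finite_presentations [simp]:
  "Idn (finite_presentations scale) (E, q) = (\<lambda>e\<in>E. e)"
  by (simp add: finite_presentations_def)

lemma Cmp_finite_presentations [simp]:
  "Cmp (finite_presentations scale) (E, q) Y Z \<psi> \<phi> = compose E \<psi> \<phi>"
  by (simp add: finite_presentations_def)

lemma is_category_finite_presentations: "is_category (finite_presentations scale)"
proof -
  have "presentation_map E q E q (\<lambda>e\<in>E. e)" for E and q :: "('a \<Rightarrow>\<^sub>0 'b) \<Rightarrow> 'c"
    by (auto simp: presentation_map_def push_id_on)
  moreover have "presentation_map E q G s (compose E \<psi> \<phi>)"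
    if "presentation_map E q F r \<phi>" "presentation_map F r G s \<psi>"
    for E F G and q :: "('a \<Rightarrow>\<^sub>0 'b) \<Rightarrow> 'c" and r s \<phi> \<psi>
    using presentation_map_compose[OF that]
      presentation_map_cong[of E "compose E \<psi> \<phi>" "\<lambda>e. \<psi> (\<phi> e)" q]
    by (simp add: compose_eq)
  moreover have "compose E \<phi> (\<lambda>e\<in>E. e) = \<phi>" if "\<phi> \<in> extensional E" for E and \<phi> :: "'a \<Rightarrow> 'a"
    using that by (auto simp: fun_eq_iff compose_def extensional_def)
  moreover have "compose E (\<lambda>e\<in>F. e) \<phi> = \<phi>"
    if "\<phi> \<in> extensional E" "presentation_map E q F r \<phi>"
    for E F and q :: "('a \<Rightarrow>\<^sub>0 'b) \<Rightarrow> 'c" and r \<phi>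
    using that by (auto simp: fun_eq_iff compose_def extensional_def presentation_map_def)
  moreover have "compose E \<chi> (compose E \<psi> \<phi>) = compose E (compose F \<chi> \<psi>) \<phi>"
    if "presentation_map E q F r \<phi>"
    for E F and q :: "('a \<Rightarrow>\<^sub>0 'b) \<Rightarrow> 'c" and r \<phi> and \<psi> \<chi> :: "'a \<Rightarrow> 'a"
    using that by (auto simp: fun_eq_iff compose_def presentation_map_def)
  ultimately show ?thesis
    unfolding is_category_def by (auto simp: split_paired_all)
qed

lemma tmod_functor_tropicalization:
  assumes v: "valuation v"
  shows "tmod_functor (finite_presentations scale) (trop_obj v) (trop_mor v)"
  unfolding tmod_functor_def trop_obj_def trop_mor_def
  using tmodule_tropicalization[OF v] trop_map_hom[OF v]
  by (auto intro!: trop_map_compose[OF v] trop_map_id[OF v] simp: compose_eq)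

text \<open>Index sets of objects are subsets of \<open>'e\<close>, so a finite subset of V has to
  be copied there; an injection exists because \<open>'e\<close> is infinite.\<close>

definition index :: "'a set \<Rightarrow> 'a \<Rightarrow> 'e::infinite" where
  "index A = (SOME j. inj_on j A)"

text \<open>The restriction of \<pi> to vectors supported in A, transported to the copy of
  A.\<close>

definition index_presentation ::
    "(('v \<Rightarrow>\<^sub>0 'k::comm_monoid_add) \<Rightarrow> 'v) \<Rightarrow> 'v set \<Rightarrow> ('e::infinite \<Rightarrow>\<^sub>0 'k) \<Rightarrow> 'v" where
  "index_presentation \<pi> A =
     (\<lambda>f\<in>free_carrier (index A ` A). \<pi> (push (inv_into A (index A)) f))"

lemma inj_on_index: "finite A \<Longrightarrow> inj_on (index A) A"
  unfolding index_def by (rule someI_ex[of "\<lambda>j. inj_on j A"]) (rule arb_inj_on_finite_infinite)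

lemma presentation_map_index:
  fixes A :: "'v set" and \<pi> :: "('v \<Rightarrow>\<^sub>0 'k::comm_monoid_add) \<Rightarrow> 'v"
  assumes "finite A"
  shows "presentation_map A \<pi> (index A ` A :: 'e::infinite set) (index_presentation \<pi> A) (index A)"
proof -
  let ?j = "index A :: 'v \<Rightarrow> 'e"
  have "index_presentation \<pi> A (push ?j f) = \<pi> f" if f: "f \<in> free_carrier A" for f
  proof -
    have "push (\<lambda>a. inv_into A ?j (?j a)) f = f"
      by (intro push_id_on[OF f] inv_into_f_f inj_on_index[OF assms])
    then show ?thesis
      by (simp add: index_presentation_def push_push push_free_carrier[OF f])
  qed
  then show ?thesis by (simp add: presentation_map_def)
qed

section \<open>Comparing finite presentations with the canonical one\<close>

context
  fixes scale :: "'k::field \<Rightarrow> 'v::ab_group_add \<Rightarrow> 'v"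
    and Basis :: "'v set"
    and \<pi> :: "('v \<Rightarrow>\<^sub>0 'k) \<Rightarrow> 'v"
  assumes fd: "finite_dimensional_vector_space scale Basis"
    and \<pi>_add: "\<And>f g. \<pi> (f + g) = \<pi> f + \<pi> g"
    and \<pi>_scale: "\<And>c f. \<pi> (scalar_mult c f) = scale c (\<pi> f)"
    and \<pi>_single: "\<And>a. \<pi> (Poly_Mapping.single a 1) = a"
begin

interpretation finite_dimensional_vector_space scale Basis by (rule fd)

text \<open>The image is a subspace containing \<open>Basis\<close>. This is where finite dimension
  enters: \<open>Basis\<close> is finite, so there are finite sets A of this kind.\<close>

lemma canonical_surj_image:
  assumes "Basis \<subseteq> A"
  shows "\<pi> ` free_carrier A = UNIV"
proof -
  have "\<pi> 0 = 0" using \<pi>_add[of 0 0] by simp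
  then have "0 \<in> \<pi> ` free_carrier A" by (metis free_carrier_closed(1) image_eqI)
  then have "subspace (\<pi> ` free_carrier A)"
    by (auto simp: subspace_def free_carrier_closed simp flip: \<pi>_add \<pi>_scale)
  moreover have "Basis \<subseteq> \<pi> ` free_carrier A"
  proof
    fix a assume "a \<in> Basis"
    then have "Poly_Mapping.single a 1 \<in> (free_carrier A :: ('v \<Rightarrow>\<^sub>0 'k) set)"
      using assms by (intro free_carrier_closed) auto
    then show "a \<in> \<pi> ` free_carrier A" using \<pi>_single by (metis image_eqI)
  qed
  ultimately show ?thesis using span_minimal span_Basis by blast
qed

lemma free_linear_surj_index:
  assumes A: "finite A" "Basis \<subseteq> A"
  shows "free_linear_surj scale (index A ` A) (index_presentation \<pi> A)"
proof -
  have "index_presentation \<pi> A (push (index A) f) = \<pi> f" "push (index A) f \<in> free_carrier (index A ` A)"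
    if "f \<in> free_carrier A" for f
    using presentation_map_index[OF A(1)] that push_free_carrier[OF that, of "index A"]
    by (auto simp: presentation_map_def)
  then have "b \<in> index_presentation \<pi> A ` free_carrier (index A ` A)" for b
    using canonical_surj_image[OF A(2)] by (metis UNIV_I image_iff)
  then show ?thesis
    by (auto simp: free_linear_surj_def index_presentation_def free_carrier_closed push_add
        push_scalar_mult \<pi>_add \<pi>_scale)
qed

text \<open>Both sides are linear and agree on x_e, because \<pi> sends the basis element indexed by
  q(x_e) to q(x_e).\<close>

lemma presentation_map_canonical:
  assumes q: "free_linear_surj scale E q"
  shows "presentation_map E q UNIV \<pi> (\<lambda>e. q (Poly_Mapping.single e 1))"
proof -
  have "\<pi> (push (\<lambda>e. q (Poly_Mapping.single e 1)) f) = q f" if f: "f \<in> free_carrier E" for f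
  proof -
    let ?x = "\<lambda>e. q (Poly_Mapping.single e 1)"
    have lin: "\<pi> (push ?x f) = (\<Sum>e\<in>Poly_Mapping.keys f.
        scale (Poly_Mapping.lookup f e) (\<pi> (push ?x (Poly_Mapping.single e 1))))"
      by (rule free_linear_sum[where q="\<lambda>f. \<pi> (push ?x f)", OF _ _ f])
        (simp_all add: push_add push_scalar_mult \<pi>_add \<pi>_scale)
    have "q f = (\<Sum>e\<in>Poly_Mapping.keys f.
        scale (Poly_Mapping.lookup f e) (q (Poly_Mapping.single e 1)))"
      by (rule free_linear_sum[OF _ _ f]) (use q in \<open>simp_all add: free_linear_surj_def\<close>)
    then show ?thesis by (simp add: lin \<pi>_single)
  qed
  then show ?thesis by (simp add: presentation_map_def)
qed

text \<open>The canonical map e -> q(x_e) takes values in A, and A is then copied into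
  \<open>'e\<close>.\<close>

lemma presentation_map_into_index:
  assumes q: "free_linear_surj scale E q" and A: "finite A"
    and im: "(\<lambda>e. q (Poly_Mapping.single e 1)) ` E \<subseteq> A"
  shows "presentation_map E q (index A ` A) (index_presentation \<pi> A)
    (\<lambda>e. index A (q (Poly_Mapping.single e 1)))"
proof -
  have "presentation_map E q A \<pi> (\<lambda>e. q (Poly_Mapping.single e 1))"
    using presentation_map_canonical[OF q] im by (simp add: presentation_map_def)
  then show ?thesis
    by (rule presentation_map_compose[OF _ presentation_map_index[OF A]])
qed

lemma index_presentation_single:
  assumes "finite A" "a \<in> A"
  shows "index_presentation \<pi> A (Poly_Mapping.single (index A a) 1) = a"
  using presentation_map_index[OF assms(1), of \<pi>] assms(2) \<pi>_single
  by (auto simp: presentation_map_def free_carrier_closed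
      dest: bspec[where x="Poly_Mapping.single a 1"])

lemma push_canonical_index:
  fixes f :: "'v \<Rightarrow>\<^sub>0 'c::comm_monoid_add"
  assumes A: "finite A" and f: "f \<in> free_carrier A"
  shows "push (\<lambda>e. index_presentation \<pi> A (Poly_Mapping.single e 1)) (push (index A) f) = f"
  unfolding push_push by (rule push_id_on[OF f]) (rule index_presentation_single[OF A])

section \<open>The cocone over finite presentations and its universal property\<close>

context
  fixes v :: "'k \<Rightarrow> tropical"
  assumes v: "valuation v"
begin

text \<open>A morphism \<phi> sends x_e to the basis element of \<phi>(e), with the same image in V.
  Hence the index maps to V commute with \<phi>, and \<open>trop_map_compose\<close>
  applies.\<close>

lemma tmod_cocone_trop_cocone:
  "tmod_cocone (finite_presentations scale) (trop_obj v) (trop_mor v) (tropicalization v UNIV \<pi>)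
    (trop_cocone v \<pi> :: 'e set \<times> (('e \<Rightarrow>\<^sub>0 'k) \<Rightarrow> 'v) \<Rightarrow> _)"
proof -
  have "trop_map v E\<^sub>1 q\<^sub>1 UNIV \<pi> (\<lambda>e. q\<^sub>1 (Poly_Mapping.single e 1)) =
      compose (carrier (tropicalization v E\<^sub>1 q\<^sub>1))
        (trop_map v E\<^sub>2 q\<^sub>2 UNIV \<pi> (\<lambda>e. q\<^sub>2 (Poly_Mapping.single e 1)))
        (trop_map v E\<^sub>1 q\<^sub>1 E\<^sub>2 q\<^sub>2 \<phi>)"
    if "free_linear_surj scale E\<^sub>2 q\<^sub>2" "presentation_map E\<^sub>1 q\<^sub>1 E\<^sub>2 q\<^sub>2 \<phi>"
    for E\<^sub>1 E\<^sub>2 :: "'e set" and q\<^sub>1 q\<^sub>2 \<phi>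
  proof (rule trop_map_compose[OF v that(2) presentation_map_canonical[OF that(1)]])
    fix e assume "e \<in> E\<^sub>1"
    then show "q\<^sub>1 (Poly_Mapping.single e 1) = q\<^sub>2 (Poly_Mapping.single (\<phi> e) 1)"
      using that(2) push_single[of \<phi> e "1::'k"]
      by (metis presentation_map_def free_carrier_closed(4))
  qed
  then show ?thesis
    unfolding tmod_cocone_def trop_obj_def trop_mor_def trop_cocone_def
    using tmodule_tropicalization[OF v] trop_map_hom[OF v presentation_map_canonical]
    by auto
qed

text \<open>
  Every \<open>f\<close> lies in \<open>free_carrier A\<close> for some finite \<open>A\<close> containing \<open>Basis\<close>, and \<open>A\<close> itself, copied
  into the type of index sets, is a finite presentation. So the value at \<open>f\<close> of the map induced by
  a cocone is read off at that presentation; the choice of \<open>A\<close> does not matter, because all these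
  presentations map to each other along inclusions.
\<close>

lemma tmod_cocone_factorization:
  fixes \<kappa> :: "'e::infinite set \<times> (('e \<Rightarrow>\<^sub>0 'k) \<Rightarrow> 'v) \<Rightarrow> ('e \<Rightarrow>\<^sub>0 tropical) set \<Rightarrow> 'n"
  assumes \<kappa>: "tmod_cocone (finite_presentations scale) (trop_obj v) (trop_mor v) N \<kappa>"
  shows "\<exists>!h. h \<in> tmod_hom (tropicalization v UNIV \<pi>) N \<and>
    (\<forall>X\<in>Obj (finite_presentations scale).
       compose (carrier (trop_obj v X)) h (trop_cocone v \<pi> X) = \<kappa> X)"
proof -
  have N: "tmodule N" using \<kappa> by (simp add: tmod_cocone_def)
  have hom: "\<kappa> (E, q) \<in> tmod_hom (tropicalization v E q) N"
    if "finite E" "free_linear_surj scale E q" for E q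
  proof -
    have "(E, q) \<in> Obj (finite_presentations scale)" using that by simp
    then have "\<kappa> (E, q) \<in> tmod_hom (trop_obj v (E, q)) N"
      using \<kappa> unfolding tmod_cocone_def by blast
    then show ?thesis by (simp add: trop_obj_def)
  qed
  \<comment> \<open>Arrows of the category are extensional, so \<phi> is first restricted to E; this
    does not change \<open>push \<phi> f\<close>.\<close>
  have compat: "\<kappa> (E, q) (trop_class v E q f) = \<kappa> (F, p) (trop_class v F p (push \<phi> f))"
    if E: "finite E" "free_linear_surj scale E q" and F: "finite F" "free_linear_surj scale F p"
      and \<phi>: "presentation_map E q F p \<phi>" and f: "f \<in> free_carrier E" for E q F p \<phi> f
  proof -
    have \<phi>': "presentation_map E q F p (restrict \<phi> E)"
      using \<phi> presentation_map_cong[of E \<phi> "restrict \<phi> E" q F p] by simp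
    then have "restrict \<phi> E \<in> Mor (finite_presentations scale) (E, q) (F, p)" by simp
    then have "compose (carrier (tropicalization v E q)) (\<kappa> (F, p))
        (trop_map v E q F p (restrict \<phi> E)) = \<kappa> (E, q)"
      using \<kappa> E F unfolding tmod_cocone_def trop_obj_def trop_mor_def by fastforce
    then have "\<kappa> (E, q) (trop_class v E q f) =
        \<kappa> (F, p) (trop_map v E q F p (restrict \<phi> E) (trop_class v E q f))"
      using compose_eq[OF trop_class_closed[OF v f]] by metis
    then show ?thesis
      using push_cong[OF f, of \<phi> "restrict \<phi> E"] by (simp add: trop_map_class[OF v \<phi>' f])
  qed
  define level where "level A f = \<kappa> (index A ` A, index_presentation \<pi> A)
      (trop_class v (index A ` A) (index_presentation \<pi> A) (push (index A) f))" for A f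
  define dom where "dom A \<longleftrightarrow> finite A \<and> Basis \<subseteq> A" for A
  have dom: "finite (index A ` A)" "free_linear_surj scale (index A ` A) (index_presentation \<pi> A)"
    if "dom A" for A
    using that free_linear_surj_index by (auto simp: dom_def)
  have push_index: "push (index A) f \<in> free_carrier (index A ` A)"
    if "f \<in> free_carrier A" for f :: "'v \<Rightarrow>\<^sub>0 tropical" and A
    by (rule push_free_carrier[OF that order_refl])
  \<comment> \<open>Compatibility of \<kappa> along e -> q(x_e), followed by the copy of A.\<close>
  have level_eq: "\<kappa> (E, q) (trop_class v E q f) =
      level A (push (\<lambda>e. q (Poly_Mapping.single e 1)) f)"
    if E: "finite E" "free_linear_surj scale E q" and f: "f \<in> free_carrier E"
      and A: "dom A" and im: "(\<lambda>e. q (Poly_Mapping.single e 1)) ` E \<subseteq> A" for E q f A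
  proof -
    have "finite A" using A by (simp add: dom_def)
    then show ?thesis
      using compat[OF E dom[OF A] presentation_map_into_index[OF E(2) _ im] f]
      by (simp add: level_def push_push)
  qed
  \<comment> \<open>An instance of \<open>level_eq\<close>: the presentation on A has its basis
    vectors sent to elements of A, hence of B, and pushing the copy of \<open>f\<close> back to V
    returns \<open>f\<close>.\<close>
  have level_mono: "level A f = level B f" if A: "dom A" "A \<subseteq> B" and B: "dom B"
    and f: "f \<in> free_carrier A" for A B f
  proof -
    have fin: "finite A" using A by (simp add: dom_def)
    have "(\<lambda>e. index_presentation \<pi> A (Poly_Mapping.single e 1)) ` (index A ` A :: 'e set)
        \<subseteq> A"
      by (auto simp: index_presentation_single[OF fin])
    then show ?thesis
      using level_eq[OF dom[OF A(1)] push_index[OF f] B] A(2)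
      by (auto simp: level_def[of A] push_canonical_index[OF fin f])
  qed
  \<comment> \<open>This is the least set A with \<open>dom A\<close> that supports
    \<open>f\<close>, so \<open>level_mono\<close> compares it with every other choice.\<close>
  define h where "h f = level (Poly_Mapping.keys f \<union> Basis) f" for f
  have h_eq: "h f = level A f" if "dom A" "f \<in> free_carrier A" for A f
    unfolding h_def
    by (rule level_mono) (use that finite_Basis in \<open>auto simp: dom_def free_carrier_def\<close>)
  \<comment> \<open>Directedness: linearity of \<open>h\<close> can be checked at one A supporting
    all vectors involved.\<close>
  have enlarge: "\<exists>A. dom A \<and> f \<in> free_carrier A \<and> g \<in> free_carrier A"
    for f g :: "'v \<Rightarrow>\<^sub>0 tropical"
    by (rule exI[of _ "Poly_Mapping.keys f \<union> Poly_Mapping.keys g \<union> Basis"])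
      (auto simp: dom_def free_carrier_def finite_Basis)
  have h_closed: "h f \<in> carrier N" for f
  proof -
    obtain A where A: "dom A" "f \<in> free_carrier A" using enlarge by blast
    then show ?thesis
      using tmod_homD(2)[OF hom[OF dom[OF A(1)]] trop_class_closed[OF v push_index[OF A(2)]]]
      by (simp add: h_eq[OF A] level_def)
  qed
  have h_add: "h (f + g) = h f \<oplus>\<^bsub>N\<^esub> h g" for f g
  proof -
    obtain A where A: "dom A" "f \<in> free_carrier A" "g \<in> free_carrier A" using enlarge by blast
    note hm = tmod_homD[OF hom[OF dom[OF A(1)]]]
    show ?thesis
      using hm(3)[OF trop_class_closed[OF v push_index[OF A(2)]] trop_class_closed[OF v push_index[OF A(3)]]]
      by (simp add: h_eq[OF A(1)] A free_carrier_closed level_def push_add push_index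
          tropicalization_simps[OF v])
  qed
  have h_smult: "h (scalar_mult c f) = c \<odot>\<^bsub>N\<^esub> h f" for c f
  proof -
    obtain A where A: "dom A" "f \<in> free_carrier A" using enlarge by blast
    note hm = tmod_homD[OF hom[OF dom[OF A(1)]]]
    show ?thesis
      using hm(5)[OF trop_class_closed[OF v push_index[OF A(2)]], of c]
      by (simp add: h_eq[OF A(1)] A free_carrier_closed level_def push_scalar_mult push_index
          tropicalization_simps[OF v])
  qed
  have h_zero: "h 0 = \<zero>\<^bsub>N\<^esub>"
  proof -
    obtain A where A: "dom A" "(0 :: 'v \<Rightarrow>\<^sub>0 tropical) \<in> free_carrier A" using enlarge by blast
    show ?thesis
      using tmod_homD(4)[OF hom[OF dom[OF A(1)]]]
      by (simp add: h_eq[OF A] level_def tropicalization_simps[OF v])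
  qed
  \<comment> \<open>Having equal values under \<open>h\<close> is a congruence, as the pullback of
    equality in \<open>N\<close>, so only the bend relations remain.\<close>
  have "trop_congruence v UNIV \<pi> \<subseteq>
      {(f, g) \<in> free_carrier UNIV \<times> free_carrier UNIV. (h f, h g) \<in> Id_on (carrier N)}"
  proof (rule trop_congruence_least[OF v])
    show "tmod_congruence (free_tmod UNIV)
        {(f, g) \<in> free_carrier UNIV \<times> free_carrier UNIV. (h f, h g) \<in> Id_on (carrier N)}"
      using tmod_congruence_pullback[OF tmodule_free_tmod tmod_congruence_Id_on[OF N], of UNIV h]
      by (simp add: h_closed h_add h_smult)
  next
    fix f t assume "\<pi> f = 0" and t: "t \<in> Poly_Mapping.keys f"
    let ?g = "Poly_Mapping.update t 0 (trop v f)"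
    define A where "A = Poly_Mapping.keys f \<union> Basis"
    have A: "dom A" by (simp add: A_def dom_def finite_Basis)
    have f: "f \<in> free_carrier A" by (auto simp: A_def free_carrier_def)
    then have fg: "trop v f \<in> free_carrier A" "?g \<in> free_carrier A"
      by (simp_all add: trop_free_carrier[OF v] free_carrier_closed)
    \<comment> \<open>The support of \<open>f\<close> lies in A, so its copy is in the kernel of the
      finite presentation on A, where \<open>push_bend\<close> gives the relation.\<close>
    have "index_presentation \<pi> A (push (index A :: 'v \<Rightarrow> 'e) f) = 0"
      using presentation_map_index[of A \<pi>] A f \<open>\<pi> f = 0\<close> by (auto simp: presentation_map_def dom_def)
    from push_bend[where \<phi>="index A" and p="index_presentation \<pi> A",
        OF v f order_refl this t]
    have "level A (trop v f) = level A ?g"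
      unfolding level_def by (simp add: trop_class_eq[OF v])
    then have "h (trop v f) = h ?g"
      using h_eq[OF A] fg by simp
    then show "(trop v f, ?g) \<in>
        {(f, g) \<in> free_carrier UNIV \<times> free_carrier UNIV. (h f, h g) \<in> Id_on (carrier N)}"
      by (simp add: h_closed Id_onI)
  qed
  then have resp: "h f = h g" if "(f, g) \<in> trop_congruence v UNIV \<pi>" for f g
    using that by auto
  obtain H where H: "H \<in> tmod_hom (tropicalization v UNIV \<pi>) N"
    and H_class: "\<And>f. H (trop_class v UNIV \<pi> f) = h f"
    by (rule tmod_quot_lift[OF tmodule_free_tmod[of UNIV] trop_congruence_congruence[OF v], of \<pi> h N])
      (use resp in \<open>auto simp: h_closed h_add h_zero h_smult simp flip: tropicalization_def\<close>)
  show ?thesis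
  proof (rule ex1I[of _ H], intro conjI ballI)
    show "H \<in> tmod_hom (tropicalization v UNIV \<pi>) N" by (rule H)
  next
    fix X assume X: "X \<in> Obj (finite_presentations scale ::
      ('e set \<times> (('e \<Rightarrow>\<^sub>0 'k) \<Rightarrow> 'v), 'e \<Rightarrow> 'e) category)"
    obtain E q where Xeq: "X = (E, q)" by (cases X)
    have E: "finite E" "free_linear_surj scale E q" using X by (simp_all add: Xeq)
    let ?x = "\<lambda>e. q (Poly_Mapping.single e 1)"
    \<comment> \<open>Large enough both for (E, q) to map to the presentation on A and for that
      presentation to be surjective.\<close>
    define A where "A = ?x ` E \<union> Basis"
    have A: "dom A" "?x ` E \<subseteq> A" using E by (auto simp: A_def dom_def finite_Basis)
    have "compose (carrier (tropicalization v E q)) H (trop_cocone v \<pi> (E, q)) = \<kappa> (E, q)"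
    proof (rule extensional_tropicalization_eqI[OF v compose_extensional tmod_homD(1)[OF hom[OF E]]])
      fix f :: "'e \<Rightarrow>\<^sub>0 tropical" assume f: "f \<in> free_carrier E"
      have "compose (carrier (tropicalization v E q)) H (trop_cocone v \<pi> (E, q)) (trop_class v E q f)
          = h (push ?x f)"
        by (simp add: compose_eq trop_class_closed[OF v f] trop_cocone_def H_class
            trop_map_class[OF v presentation_map_canonical[OF E(2)] f])
      also have "\<dots> = level A (push ?x f)"
        by (rule h_eq[OF A(1) push_free_carrier[OF f A(2)]])
      also have "\<dots> = \<kappa> (E, q) (trop_class v E q f)"
        by (rule level_eq[OF E f A, symmetric])
      finally show "compose (carrier (tropicalization v E q)) H (trop_cocone v \<pi> (E, q))
          (trop_class v E q f) = \<kappa> (E, q) (trop_class v E q f)" .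
    qed
    then show "compose (carrier (trop_obj v X)) H (trop_cocone v \<pi> X) = \<kappa> X"
      by (simp add: Xeq trop_obj_def)
  next
    fix H' assume H': "H' \<in> tmod_hom (tropicalization v UNIV \<pi>) N \<and>
      (\<forall>X\<in>Obj (finite_presentations scale).
         compose (carrier (trop_obj v X)) H' (trop_cocone v \<pi> X) = \<kappa> X)"
    \<comment> \<open>Each class in the tropicalization of \<pi> is the image, under the cocone, of
      a class at the presentation on some A, where \<kappa> prescribes the value of
      \<open>H'\<close>.\<close>
    show "H' = H"
    proof (rule extensional_tropicalization_eqI[OF v tmod_homD(1) tmod_homD(1)[OF H]])
      show "H' \<in> tmod_hom (tropicalization v UNIV \<pi>) N" using H' by blast
    next
      fix f :: "'v \<Rightarrow>\<^sub>0 tropical"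
      obtain A where A: "dom A" "f \<in> free_carrier A" using enlarge by blast
      then have fin: "finite A" by (simp add: dom_def)
      let ?E = "index A ` A :: 'e set" and ?q = "index_presentation \<pi> A :: ('e \<Rightarrow>\<^sub>0 'k) \<Rightarrow> 'v"
      let ?X = "trop_class v ?E ?q (push (index A) f)"
      have E: "(?E, ?q) \<in> Obj (finite_presentations scale)" "free_linear_surj scale ?E ?q"
        using dom[OF A(1)] by simp_all
      have g: "push (index A) f \<in> free_carrier ?E" by (rule push_index[OF A(2)])
      have "compose (carrier (tropicalization v ?E ?q)) H' (trop_cocone v \<pi> (?E, ?q)) = \<kappa> (?E, ?q)"
        using bspec[OF conjunct2[OF H'] E(1)] by (simp add: trop_obj_def)
      then have "\<kappa> (?E, ?q) ?X = H' (trop_cocone v \<pi> (?E, ?q) ?X)"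
        using compose_eq[OF trop_class_closed[OF v g]] by metis
      also have "trop_cocone v \<pi> (?E, ?q) ?X = trop_class v UNIV \<pi> f"
        by (simp add: trop_cocone_def trop_map_class[OF v presentation_map_canonical[OF E(2)] g]
            push_canonical_index[OF fin A(2)])
      finally show "H' (trop_class v UNIV \<pi> f) = H (trop_class v UNIV \<pi> f)"
        by (simp add: H_class h_eq[OF A] level_def)
    qed
  qed
qed

end

end

theorem theorem2p1p5:
  fixes v :: "'k::field \<Rightarrow> tropical"
    and scale :: "'k \<Rightarrow> 'v::ab_group_add \<Rightarrow> 'v"
    and Basis :: "'v set"
    and \<pi> :: "('v \<Rightarrow>\<^sub>0 'k) \<Rightarrow> 'v"
    and P :: "('e::infinite set \<times> (('e \<Rightarrow>\<^sub>0 'k) \<Rightarrow> 'v), 'e \<Rightarrow> 'e) category"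
  assumes "valuation v"
    and "finite_dimensional_vector_space scale Basis"
    and "\<forall>f g. \<pi> (f + g) = \<pi> f + \<pi> g"
    and "\<forall>c f. \<pi> (scalar_mult c f) = scale c (\<pi> f)"
    and "\<forall>a. \<pi> (Poly_Mapping.single a 1) = a"
    and "P = finite_presentations scale"
  shows "is_category P \<and>
    tmod_functor P (trop_obj v) (trop_mor v) \<and>
    (\<forall>(E\<^sub>1, q\<^sub>1)\<in>Obj P. \<forall>(E\<^sub>2, q\<^sub>2)\<in>Obj P. \<forall>\<phi>\<in>Mor P (E\<^sub>1, q\<^sub>1) (E\<^sub>2, q\<^sub>2). \<forall>e\<in>E\<^sub>1.
       trop_mor v (E\<^sub>1, q\<^sub>1) (E\<^sub>2, q\<^sub>2) \<phi> (trop_generator v E\<^sub>1 q\<^sub>1 e) = trop_generator v E\<^sub>2 q\<^sub>2 (\<phi> e)) \<and>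
    (\<forall>(E, q)\<in>Obj P. \<forall>e\<in>E.
       trop_cocone v \<pi> (E, q) (trop_generator v E q e) =
         trop_generator v UNIV \<pi> (q (Poly_Mapping.single e 1))) \<and>
    tmod_colimit TYPE('n) P (trop_obj v) (trop_mor v) (tropicalization v UNIV \<pi>) (trop_cocone v \<pi>)"
proof -
  have \<pi>: "\<And>f g. \<pi> (f + g) = \<pi> f + \<pi> g" "\<And>c f. \<pi> (scalar_mult c f) = scale c (\<pi> f)"
    "\<And>a. \<pi> (Poly_Mapping.single a 1) = a"
    using assms by auto
  note ctx = assms(2) \<pi> assms(1)
  have "tmod_colimit TYPE('n) P (trop_obj v) (trop_mor v) (tropicalization v UNIV \<pi>) (trop_cocone v \<pi>)"
    unfolding tmod_colimit_def assms(6)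
    using tmod_cocone_trop_cocone[OF ctx] tmod_cocone_factorization[OF ctx] by blast
  moreover have "is_category P" "tmod_functor P (trop_obj v) (trop_mor v)"
    unfolding assms(6)
    by (rule is_category_finite_presentations, rule tmod_functor_tropicalization[OF assms(1)])
  ultimately show ?thesis
    unfolding assms(6) trop_mor_def trop_cocone_def
    by (simp add: split_paired_all trop_map_generator[OF assms(1)]
        trop_map_generator[OF assms(1) presentation_map_canonical[OF assms(2) \<pi>]])
qed

end
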